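(* Let $m>0$ and, for $q=(q_1,q_2,q_3)\in\mathbb{R}^3$, let $$H(q)=\begin{bmatrix} m & 0 & q_3 & q_1-\mathrm{i}q_2\\ 0 & m & q_1+\mathrm{i}q_2 & -q_3\\ q_3 & q_1-\mathrm{i}q_2 & -m & 0\\ q_1+\mathrm{i}q_2 & -q_3 & 0 & -m\end{bmatrix}.$$ Consider the self-adjoint operators (acting on $\mathbb{C}^4$-valued functions of $q\in\mathbb{R}^3$) $$(A_0\Phi)(q)=H(q)\Phi(q),\qquad (A\Phi)(q)=H(q)\Phi(q)+\int_{\mathbb{R}^3}U(q,r)\Phi(r)\,dr .$$ Let the generalized wave operators $W_\pm(A,A_0)$ exist. Then the corresponding scattering operator $S(q)$ and the deviation factor $\widetilde W_0(t,q)$ (which for each $q$ are transformations of $\mathbb{C}^4$) have the following structure: $$S(q)=\sum_{n=1}^{2}s_n(q),\qquad \widetilde W_0(t,q)=\sum_{n=1}^{2}w_n(t,q),$$ where $$s_n(q)=P_n(q)S(q)P_n(q),\qquad w_n(t,q)=P_n(q)\widetilde W_0(t,q)P_n(q),$$ $P_n(q)$ is the orthogonal projector of the space $\mathbb{C}^4$ onto $M_n(q)$, and $M_1(q)=\mathrm{Span}\{g_1(q),g_2(q)\}$, $M_2(q)=\mathrm{Span}\{g_3(q),g_4(q)\}$ with the eigenvectors $g_k(q)$ of $H(q)$ given in the context.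
   Context: Eigenvectors: put $\lambda_3=\sqrt{m^2+|q|^2}$, $|q|^2=q_1^2+q_2^2+q_3^2$. Then $g_1,g_2$ are eigenvectors of $H(q)$ with eigenvalue $-\sqrt{m^2+|q|^2}$ and $g_3,g_4$ are eigenvectors with eigenvalue $\sqrt{m^2+|q|^2}$, where $$g_1=\begin{bmatrix}\frac{-q_1+\mathrm{i}q_2}{m+\lambda_3}\\ \frac{q_3}{m+\lambda_3}\\0\\1\end{bmatrix},\quad g_2=\begin{bmatrix}\frac{-q_3}{m+\lambda_3}\\ \frac{-q_1-\mathrm{i}q_2}{m+\lambda_3}\\1\\0\end{bmatrix},\quad g_3=\begin{bmatrix}\frac{-q_1+\mathrm{i}q_2}{m-\lambda_3}\\ \frac{q_3}{m-\lambda_3}\\0\\1\end{bmatrix},\quad g_4=\begin{bmatrix}\frac{-q_3}{m-\lambda_3}\\ \frac{-q_1-\mathrm{i}q_2}{m-\lambda_3}\\1\\0\end{bmatrix}.$$ Generalized wave operators: let $A_0$ be a self-adjoint operator and $A$ a linear operator in a Hilbert space, $G_0$ the absolutely continuous subspace of $A_0$, $P_0$ (not to be confused with $P_1(q),P_2(q)$) the orthogonal projector onto $G_0$. An operator function $W_0(t)$, $|t|>R$ (for some $R\ge0$), with values acting in $G_0$ is called a deviation factor, and $W_\pm(A,A_0)$ are called generalized wave operators, if: (1) $W_0(t)$ and $W_0(t)^{-1}$ are bounded in $G_0$ for all $|t|>R$, and $\lim_{t\to\pm\infty}W_0(t+\tau)W_0(t)^{-1}P_0=P_0$ for real $\tau$;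 (2) $W_0(t)A_0P_0=A_0W_0(t)P_0$ and $W_0(t)W_0(t+\tau)P_0=W_0(t+\tau)W_0(t)P_0$ for arbitrary $t$ and $\tau$; (3) the limits $W_\pm(A,A_0)=\lim_{t\to\pm\infty}\big[\mathrm{e}^{\mathrm{i}At}\mathrm{e}^{-\mathrm{i}A_0t}W_0(t)^{-1}\big]P_0$ exist in the sense of strong convergence. The generalized scattering operator is $S(A,A_0)=W_+(A,A_0)^*W_-(A,A_0)$. $S(q)$ and $\widetilde W_0(t,q)$ denote the scattering operator and the deviation factor in the momentum representation, written as matrix functions of the momentum $q$. *)

theory Defs
  imports "HOL-Analysis.Analysis"
begin

section \<open>Complex Hilbert spaces\<close>

text \<open>The inner product \<open>cinner\<close> is linear in its first argument; its real part is the inner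
  product of the underlying real Hilbert space, so the norm is \<open>sqrt (Re (cinner x x))\<close>.\<close>

class complex_inner = real_inner +
  fixes scaleC :: "complex \<Rightarrow> 'a \<Rightarrow> 'a" (infixr "*\<^sub>C" 75)
    and cinner :: "'a \<Rightarrow> 'a \<Rightarrow> complex"
  assumes scaleC_add_right: "c *\<^sub>C (x + y) = c *\<^sub>C x + c *\<^sub>C y"
    and scaleC_add_left: "(c + d) *\<^sub>C x = c *\<^sub>C x + d *\<^sub>C x"
    and scaleC_scaleC: "c *\<^sub>C d *\<^sub>C x = (c * d) *\<^sub>C x"
    and scaleC_of_real: "complex_of_real r *\<^sub>C x = r *\<^sub>R x"
    and cinner_commute: "cinner x y = cnj (cinner y x)"
    and cinner_add_left: "cinner (x + y) z = cinner x z + cinner y z"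
    and cinner_scaleC_left: "cinner (c *\<^sub>C x) y = c * cinner x y"
    and Re_cinner: "Re (cinner x y) = inner x y"

class chilbert_space = complex_inner + complete_space

section \<open>Linear operators in a Hilbert space\<close>

text \<open>An everywhere defined operator is a function \<open>'h \<Rightarrow> 'h\<close>. An unbounded operator is a partial
  function \<open>'h \<rightharpoonup> 'h\<close>; its domain is \<open>dom\<close>, and equality of such operators includes equality
  of the domains.\<close>

definition csubspace :: "'h::complex_inner set \<Rightarrow> bool" where
  "csubspace D \<longleftrightarrow> 0 \<in> D \<and> (\<forall>x\<in>D. \<forall>y\<in>D. x + y \<in> D) \<and> (\<forall>c. \<forall>x\<in>D. c *\<^sub>C x \<in> D)"

definition clinear_on :: "'h::complex_inner set \<Rightarrow> ('h \<Rightarrow> 'h) \<Rightarrow> bool" where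
  "clinear_on D T \<longleftrightarrow> csubspace D \<and> (\<forall>x\<in>D. \<forall>y\<in>D. T (x + y) = T x + T y) \<and>
     (\<forall>c. \<forall>x\<in>D. T (c *\<^sub>C x) = c *\<^sub>C T x)"

definition bounded_clinear_on :: "'h::complex_inner set \<Rightarrow> ('h \<Rightarrow> 'h) \<Rightarrow> bool" where
  "bounded_clinear_on D T \<longleftrightarrow> clinear_on D T \<and> (\<exists>K. \<forall>x\<in>D. norm (T x) \<le> K * norm x)"

definition linear_operator :: "('h::complex_inner \<rightharpoonup> 'h) \<Rightarrow> bool" where
  "linear_operator A \<longleftrightarrow> clinear_on (dom A) (\<lambda>f. the (A f))"

text \<open>If \<open>dom A\<close> is dense, the vector \<open>k\<close> below is unique.\<close>

definition adjoint_operator :: "('h::complex_inner \<rightharpoonup> 'h) \<Rightarrow> ('h \<rightharpoonup> 'h)" where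
  "adjoint_operator A g =
     (if \<exists>k. \<forall>f\<in>dom A. cinner (the (A f)) g = cinner f k
      then Some (THE k. \<forall>f\<in>dom A. cinner (the (A f)) g = cinner f k) else None)"

definition self_adjoint :: "('h::complex_inner \<rightharpoonup> 'h) \<Rightarrow> bool" where
  "self_adjoint A \<longleftrightarrow>
     linear_operator A \<and> closure (dom A) = UNIV \<and> adjoint_operator A = A"

definition is_adjoint :: "('h::complex_inner \<Rightarrow> 'h) \<Rightarrow> ('h \<Rightarrow> 'h) \<Rightarrow> bool" where
  "is_adjoint T T' \<longleftrightarrow> (\<forall>f g. cinner (T f) g = cinner f (T' g))"

definition proj_onto :: "'h::complex_inner set \<Rightarrow> 'h \<Rightarrow> 'h" where
  "proj_onto G f = (THE g. g \<in> G \<and> (\<forall>h\<in>G. cinner (f - g) h = 0))"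

text \<open>\<open>V t = exp (i t A)\<close>, i.e. \<open>V\<close> is the strongly continuous one-parameter group of bounded
  operators with infinitesimal generator \<open>i A\<close>. The group is determined by \<open>A\<close>; it exists and is
  unitary when \<open>A\<close> is self-adjoint (Stone's theorem).\<close>

definition exp_i_group :: "('h::complex_inner \<rightharpoonup> 'h) \<Rightarrow> (real \<Rightarrow> 'h \<Rightarrow> 'h) \<Rightarrow> bool" where
  "exp_i_group A V \<longleftrightarrow>
     (\<forall>t. bounded_clinear_on UNIV (V t)) \<and> V 0 = id \<and> (\<forall>s t. V (s + t) = V s \<circ> V t) \<and>
     (\<forall>f. continuous_on UNIV (\<lambda>t. V t f)) \<and>
     (\<forall>f g. A f = Some g \<longleftrightarrow> ((\<lambda>t. V t f) has_vector_derivative \<i> *\<^sub>C g) (at 0))"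

section \<open>The absolutely continuous subspace\<close>

text \<open>The measure \<open>B \<mapsto> \<langle>E B f, f\<rangle>\<close> of a vector \<open>f\<close>.\<close>

definition vector_measure :: "(real set \<Rightarrow> 'h::complex_inner \<Rightarrow> 'h) \<Rightarrow> 'h \<Rightarrow> real measure" where
  "vector_measure E f = measure_of UNIV (sets borel) (\<lambda>B. ennreal (Re (cinner (E B f) f)))"

text \<open>\<open>E\<close> is the projection-valued spectral measure of \<open>A\<close>, i.e. \<open>A = \<integral> \<lambda> dE(\<lambda>)\<close>. The linear
  operator \<open>A\<close> is determined by its quadratic form (polarization).\<close>

definition spectral_measure :: "('h::complex_inner \<rightharpoonup> 'h) \<Rightarrow> (real set \<Rightarrow> 'h \<Rightarrow> 'h) \<Rightarrow> bool" where
  "spectral_measure A E \<longleftrightarrow>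
     linear_operator A \<and>
     (\<forall>B\<in>sets borel. clinear_on UNIV (E B) \<and> E B \<circ> E B = E B \<and> is_adjoint (E B) (E B)) \<and>
     E UNIV = id \<and>
     (\<forall>B f. range B \<subseteq> sets borel \<and> disjoint_family B \<longrightarrow> (\<lambda>n. E (B n) f) sums E (\<Union>n. B n) f) \<and>
     dom A = {f. integrable (vector_measure E f) (\<lambda>x. x\<^sup>2)} \<and>
     (\<forall>f\<in>dom A. cinner (the (A f)) f = complex_of_real (\<integral>x. x \<partial>vector_measure E f))"

definition ac_subspace :: "('h::complex_inner \<rightharpoonup> 'h) \<Rightarrow> 'h set" where
  "ac_subspace A =
     {f. \<exists>E. spectral_measure A E \<and> absolutely_continuous lborel (vector_measure E f)}"

section \<open>Generalized wave operators\<close>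

text \<open>\<open>W0 t\<close> acts in the absolutely continuous subspace \<open>G\<close> of \<open>A0\<close> and \<open>inv_into G (W0 t)\<close> is
  its inverse there. All limits are strong ones. The third clause is an equality of unbounded
  operators: a vector lies in the domain of the left side iff it lies in that of the right side.\<close>

definition deviation_factor ::
  "('h::complex_inner \<rightharpoonup> 'h) \<Rightarrow> real \<Rightarrow> (real \<Rightarrow> 'h \<Rightarrow> 'h) \<Rightarrow> bool" where
  "deviation_factor A0 R W0 \<longleftrightarrow>
     (let G = ac_subspace A0; P0 = proj_onto G in
      0 \<le> R \<and>
      (\<forall>t. R < \<bar>t\<bar> \<longrightarrow> bij_betw (W0 t) G G \<and> bounded_clinear_on G (W0 t) \<and>
         bounded_clinear_on G (inv_into G (W0 t))) \<and>
      (\<forall>\<tau> f. ((\<lambda>t. W0 (t + \<tau>) (inv_into G (W0 t) (P0 f))) \<longlongrightarrow> P0 f) at_top \<and>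
             ((\<lambda>t. W0 (t + \<tau>) (inv_into G (W0 t) (P0 f))) \<longlongrightarrow> P0 f) at_bot) \<and>
      (\<forall>t f. R < \<bar>t\<bar> \<longrightarrow> map_option (W0 t) (A0 (P0 f)) = A0 (W0 t (P0 f))) \<and>
      (\<forall>t \<tau> f. R < \<bar>t\<bar> \<and> R < \<bar>t + \<tau>\<bar> \<longrightarrow>
         W0 t (W0 (t + \<tau>) (P0 f)) = W0 (t + \<tau>) (W0 t (P0 f))))"

definition generalized_wave_operators ::
  "('h::complex_inner \<rightharpoonup> 'h) \<Rightarrow> ('h \<rightharpoonup> 'h) \<Rightarrow> real \<Rightarrow> (real \<Rightarrow> 'h \<Rightarrow> 'h) \<Rightarrow>
     ('h \<Rightarrow> 'h) \<Rightarrow> ('h \<Rightarrow> 'h) \<Rightarrow> bool" where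
  "generalized_wave_operators A A0 R W0 Wp Wm \<longleftrightarrow>
     deviation_factor A0 R W0 \<and>
     (let G = ac_subspace A0; P0 = proj_onto G in
      \<exists>V V0. exp_i_group A V \<and> exp_i_group A0 V0 \<and>
        (\<forall>f. ((\<lambda>t. V t (V0 (- t) (inv_into G (W0 t) (P0 f)))) \<longlongrightarrow> Wp f) at_top \<and>
             ((\<lambda>t. V t (V0 (- t) (inv_into G (W0 t) (P0 f)))) \<longlongrightarrow> Wm f) at_bot))"

text \<open>\<open>S = W\<^sub>+\<^sup>* W\<^sub>-\<close>\<close>

definition scattering_operator ::
  "('h::complex_inner \<Rightarrow> 'h) \<Rightarrow> ('h \<Rightarrow> 'h) \<Rightarrow> ('h \<Rightarrow> 'h) \<Rightarrow> bool" where
  "scattering_operator Wp Wm S \<longleftrightarrow> (\<exists>Wp'. is_adjoint Wp Wp' \<and> S = Wp' \<circ> Wm)"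

section \<open>The Hilbert space of square integrable spinor fields\<close>

definition cdot :: "complex^'n \<Rightarrow> complex^'n \<Rightarrow> complex" where
  "cdot v w = (\<Sum>i\<in>UNIV. v $ i * cnj (w $ i))"

definition square_integrable :: "(real^3 \<Rightarrow> complex^4) \<Rightarrow> bool" where
  "square_integrable f \<longleftrightarrow>
     f \<in> borel_measurable lebesgue \<and> integrable lebesgue (\<lambda>q. (norm (f q))\<^sup>2)"

definition L2_eq :: "(real^3 \<Rightarrow> complex^4) \<Rightarrow> (real^3 \<Rightarrow> complex^4) \<Rightarrow> bool" where
  "L2_eq f g \<longleftrightarrow> square_integrable f \<and> square_integrable g \<and> (AE q in lebesgue. f q = g q)"

lemma square_integrable_0: "square_integrable (\<lambda>q. 0)"
  by (simp add: square_integrable_def)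

lemma square_integrable_measurable [measurable_dest]:
  "square_integrable f \<Longrightarrow> f \<in> borel_measurable lebesgue"
  by (simp add: square_integrable_def)

lemma square_integrable_add:
  assumes "square_integrable f" "square_integrable g"
  shows "square_integrable (\<lambda>q. f q + g q)"
proof -
  have [measurable]: "f \<in> borel_measurable lebesgue" "g \<in> borel_measurable lebesgue"
    using assms by (auto simp: square_integrable_def)
  have "integrable lebesgue (\<lambda>q. (norm (f q + g q))\<^sup>2)"
  proof (rule Bochner_Integration.integrable_bound)
    show "integrable lebesgue (\<lambda>q. 2 * (norm (f q))\<^sup>2 + 2 * (norm (g q))\<^sup>2)"
      using assms by (auto simp: square_integrable_def)
    have "(norm (f q + g q))\<^sup>2 \<le> 2 * (norm (f q))\<^sup>2 + 2 * (norm (g q))\<^sup>2" for q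
    proof -
      have "(norm (f q + g q))\<^sup>2 \<le> (norm (f q) + norm (g q))\<^sup>2"
        by (simp add: norm_triangle_ineq power_mono)
      also have "\<dots> \<le> 2 * (norm (f q))\<^sup>2 + 2 * (norm (g q))\<^sup>2"
        using sum_squares_bound[of "norm (f q)" "norm (g q)"] by (simp add: power2_sum)
      finally show ?thesis .
    qed
    then show "AE q in lebesgue. norm ((norm (f q + g q))\<^sup>2)
        \<le> norm (2 * (norm (f q))\<^sup>2 + 2 * (norm (g q))\<^sup>2)"
      by simp
  qed measurable
  then show ?thesis by (simp add: square_integrable_def)
qed

lemma norm_vec_scaleC: "norm (c *s v) = cmod c * norm (v :: complex^'n)"
  by (simp add: norm_vec_def norm_mult L2_set_right_distrib)

lemma bounded_linear_scaleC: "bounded_linear (\<lambda>v :: complex^'n. c *s v)"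
  by (rule bounded_linear_intro[where K = "cmod c"])
     (auto simp: vec_eq_iff algebra_simps norm_vec_scaleC)

lemma square_integrable_scaleC:
  assumes "square_integrable f"
  shows "square_integrable (\<lambda>q. c *s f q)"
proof -
  have [measurable]: "f \<in> borel_measurable lebesgue"
    using assms by (auto simp: square_integrable_def)
  have "(\<lambda>q. c *s f q) \<in> borel_measurable lebesgue"
    using bounded_linear_scaleC[of c]
    by (intro borel_measurable_continuous_on[of "\<lambda>v. c *s v"] linear_continuous_on) auto
  then show ?thesis using assms
    by (simp add: square_integrable_def norm_vec_scaleC power_mult_distrib)
qed

lemma scaleR_eq_scaleC: "r *\<^sub>R (v :: complex^'n) = complex_of_real r *s v"
  by (simp add: vec_eq_iff scaleR_conv_of_real[where 'a = complex])

lemma square_integrable_scaleR: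
  "square_integrable f \<Longrightarrow> square_integrable (\<lambda>q. r *\<^sub>R f q)"
  by (simp add: scaleR_eq_scaleC square_integrable_scaleC)

lemma square_integrable_minus: "square_integrable f \<Longrightarrow> square_integrable (\<lambda>q. - f q)"
  using square_integrable_scaleR[of f "-1"] by simp

lemma square_integrable_diff:
  "square_integrable f \<Longrightarrow> square_integrable g \<Longrightarrow> square_integrable (\<lambda>q. f q - g q)"
  using square_integrable_add[of f "\<lambda>q. - g q"] square_integrable_minus[of g] by simp

lemma cdot_add_left: "cdot (u + v) w = cdot u w + cdot v w"
  by (simp add: cdot_def algebra_simps sum.distrib)

lemma cdot_scaleC_left: "cdot (c *s v) w = c * cdot v w"
  by (simp add: cdot_def algebra_simps sum_distrib_left)

lemma cdot_commute: "cdot v w = cnj (cdot w v)"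
  by (simp add: cdot_def algebra_simps)

lemma Re_cdot: "Re (cdot v w) = inner v w"
  by (simp add: cdot_def inner_vec_def inner_complex_def)

lemma cdot_self: "cdot v v = complex_of_real ((norm v)\<^sup>2)"
  by (simp add: complex_eq_iff Re_cdot power2_norm_eq_inner)
     (simp add: cdot_def)

lemma cdot_bound: "cmod (cdot v w) \<le> 2 * (norm v)\<^sup>2 + 2 * (norm w)\<^sup>2"
proof -
  have Im: "Im (cdot v w) = Re (cdot ((- \<i>) *s v) w)"
    unfolding cdot_scaleC_left by simp
  have "cmod (cdot v w) \<le> \<bar>Re (cdot v w)\<bar> + \<bar>Im (cdot v w)\<bar>"
    by (rule cmod_le)
  also have "\<dots> \<le> norm v * norm w + norm ((- \<i>) *s v) * norm w"
    unfolding Im unfolding Re_cdot by (intro add_mono Cauchy_Schwarz_ineq2)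
  also have "\<dots> = 2 * (norm v * norm w)"
    unfolding norm_vec_scaleC by simp
  also have "\<dots> \<le> (norm v)\<^sup>2 + (norm w)\<^sup>2"
    using sum_squares_bound[of "norm v" "norm w"] by simp
  finally show ?thesis by (smt (verit) zero_le_power2)
qed

lemma cdot_measurable [measurable (raw)]:
  fixes f g :: "'x \<Rightarrow> complex^'n"
  assumes [measurable]: "f \<in> borel_measurable M" "g \<in> borel_measurable M"
  shows "(\<lambda>q. cdot (f q) (g q)) \<in> borel_measurable M"
proof -
  have comp: "(\<lambda>q. h q $ i) \<in> borel_measurable M"
    if "h \<in> borel_measurable M" for h :: "'x \<Rightarrow> complex^'n" and i
    by (rule borel_measurable_continuous_on[OF _ that]) (auto intro!: continuous_intros)
  have "(\<lambda>q. cnj (g q $ i)) \<in> borel_measurable M" for i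
    by (rule borel_measurable_continuous_on[OF _ comp[OF assms(2)]])
       (auto intro!: continuous_intros)
  then show ?thesis
    unfolding cdot_def using comp[OF assms(1)]
    by (intro borel_measurable_sum borel_measurable_times) auto
qed

lemma integrable_cdot:
  assumes "square_integrable f" "square_integrable g"
  shows "integrable lebesgue (\<lambda>q. cdot (f q) (g q))"
proof (rule Bochner_Integration.integrable_bound)
  show "integrable lebesgue (\<lambda>q. 2 * (norm (f q))\<^sup>2 + 2 * (norm (g q))\<^sup>2)"
    using assms by (auto simp: square_integrable_def)
  show "(\<lambda>q. cdot (f q) (g q)) \<in> borel_measurable lebesgue"
    using assms by (auto simp: square_integrable_def)
  show "AE q in lebesgue. norm (cdot (f q) (g q))
      \<le> norm (2 * (norm (f q))\<^sup>2 + 2 * (norm (g q))\<^sup>2)"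
    using cdot_bound by (auto simp: order_trans)
qed

lemma integrable_inner:
  assumes "square_integrable f" "square_integrable g"
  shows "integrable lebesgue (\<lambda>q. inner (f q) (g q))"
  using integrable_Re[OF integrable_cdot[OF assms]] by (simp add: Re_cdot)

text \<open>\<open>L\<^sup>2(\<real>\<^sup>3; \<complex>\<^sup>4)\<close>: square integrable functions modulo equality almost everywhere. A field \<open>\<Phi>\<close>
  has \<open>spinor_fun \<Phi>\<close> as a (chosen) representative.\<close>

quotient_type spinor_field = "real^3 \<Rightarrow> complex^4" / partial: L2_eq
  morphisms spinor_fun mk_spinor
proof (rule part_equivpI)
  show "\<exists>f. L2_eq f f"
    using square_integrable_0 by (auto simp: L2_eq_def)
  show "symp L2_eq"
    by (auto simp: symp_def L2_eq_def)
  show "transp L2_eq"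
    by (auto simp: transp_def L2_eq_def)
qed


lemma L2_eq_spinor_fun: "L2_eq (spinor_fun \<Phi>) (spinor_fun \<Phi>)"
  using Quotient3_rep_reflp[OF Quotient3_spinor_field] .

lemma square_integrable_spinor_fun: "square_integrable (spinor_fun \<Phi>)"
  using L2_eq_spinor_fun[of \<Phi>] by (simp add: L2_eq_def)

lemma spinor_fun_measurable [measurable]: "spinor_fun \<Phi> \<in> borel_measurable lebesgue"
  using square_integrable_spinor_fun[of \<Phi>] by (simp add: square_integrable_def)

lemma spinor_fun_mk:
  assumes "square_integrable f"
  shows "AE q in lebesgue. spinor_fun (mk_spinor f) q = f q"
proof -
  have "L2_eq f f" using assms by (simp add: L2_eq_def)
  then have "L2_eq (spinor_fun (mk_spinor f)) f"
    using rep_abs_rsp_left[OF Quotient3_spinor_field, of f f] by simp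
  then show ?thesis by (simp add: L2_eq_def)
qed

lemma spinor_eqI:
  assumes "AE q in lebesgue. spinor_fun \<Phi> q = spinor_fun \<Psi> q"
  shows "\<Phi> = \<Psi>"
proof -
  have "L2_eq (spinor_fun \<Phi>) (spinor_fun \<Psi>)"
    using assms by (simp add: L2_eq_def square_integrable_spinor_fun)
  then show ?thesis
    using Quotient3_rel_rep[OF Quotient3_spinor_field] by blast
qed

instantiation spinor_field :: complex_inner
begin

definition zero_spinor_field :: spinor_field where
  "0 = mk_spinor (\<lambda>q. 0)"

definition plus_spinor_field :: "spinor_field \<Rightarrow> spinor_field \<Rightarrow> spinor_field" where
  "\<Phi> + \<Psi> = mk_spinor (\<lambda>q. spinor_fun \<Phi> q + spinor_fun \<Psi> q)"

definition minus_spinor_field :: "spinor_field \<Rightarrow> spinor_field \<Rightarrow> spinor_field" where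
  "\<Phi> - \<Psi> = mk_spinor (\<lambda>q. spinor_fun \<Phi> q - spinor_fun \<Psi> q)"

definition uminus_spinor_field :: "spinor_field \<Rightarrow> spinor_field" where
  "- \<Phi> = mk_spinor (\<lambda>q. - spinor_fun \<Phi> q)"

definition scaleR_spinor_field :: "real \<Rightarrow> spinor_field \<Rightarrow> spinor_field" where
  "r *\<^sub>R \<Phi> = mk_spinor (\<lambda>q. r *\<^sub>R spinor_fun \<Phi> q)"

definition scaleC_spinor_field :: "complex \<Rightarrow> spinor_field \<Rightarrow> spinor_field" where
  "c *\<^sub>C \<Phi> = mk_spinor (\<lambda>q. c *s spinor_fun \<Phi> q)"

definition inner_spinor_field :: "spinor_field \<Rightarrow> spinor_field \<Rightarrow> real" where
  "inner \<Phi> \<Psi> = (\<integral>q. inner (spinor_fun \<Phi> q) (spinor_fun \<Psi> q) \<partial>lebesgue)"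

definition cinner_spinor_field :: "spinor_field \<Rightarrow> spinor_field \<Rightarrow> complex" where
  "cinner \<Phi> \<Psi> = (\<integral>q. cdot (spinor_fun \<Phi> q) (spinor_fun \<Psi> q) \<partial>lebesgue)"

definition norm_spinor_field :: "spinor_field \<Rightarrow> real" where
  "norm \<Phi> = sqrt (inner \<Phi> \<Phi>)" for \<Phi> :: spinor_field

definition sgn_spinor_field :: "spinor_field \<Rightarrow> spinor_field" where
  "sgn \<Phi> = inverse (norm \<Phi>) *\<^sub>R \<Phi>" for \<Phi> :: spinor_field

definition dist_spinor_field :: "spinor_field \<Rightarrow> spinor_field \<Rightarrow> real" where
  "dist \<Phi> \<Psi> = norm (\<Phi> - \<Psi>)" for \<Phi> \<Psi> :: spinor_field

definition uniformity_spinor_field :: "(spinor_field \<times> spinor_field) filter" where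
  "uniformity_spinor_field = (INF e\<in>{0<..}. principal {(\<Phi>, \<Psi>). dist \<Phi> \<Psi> < e})"

definition open_spinor_field :: "spinor_field set \<Rightarrow> bool" where
  "open_spinor_field X \<longleftrightarrow>
     (\<forall>\<Phi>\<in>X. \<forall>\<^sub>F (\<Phi>', \<Psi>) in uniformity. \<Phi>' = \<Phi> \<longrightarrow> \<Psi> \<in> X)"

lemma AE_spinor_fun:
  shows "AE q in lebesgue. spinor_fun 0 q = 0"
    and "AE q in lebesgue. spinor_fun (\<Phi> + \<Psi>) q = spinor_fun \<Phi> q + spinor_fun \<Psi> q"
    and "AE q in lebesgue. spinor_fun (\<Phi> - \<Psi>) q = spinor_fun \<Phi> q - spinor_fun \<Psi> q"
    and "AE q in lebesgue. spinor_fun (- \<Phi>) q = - spinor_fun \<Phi> q"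
    and "AE q in lebesgue. spinor_fun (r *\<^sub>R \<Phi>) q = r *\<^sub>R spinor_fun \<Phi> q"
    and "AE q in lebesgue. spinor_fun (c *\<^sub>C \<Phi>) q = c *s spinor_fun \<Phi> q"
  unfolding zero_spinor_field_def plus_spinor_field_def minus_spinor_field_def
    uminus_spinor_field_def scaleR_spinor_field_def scaleC_spinor_field_def
  by (intro spinor_fun_mk square_integrable_0 square_integrable_add square_integrable_diff
      square_integrable_minus square_integrable_scaleR square_integrable_scaleC
      square_integrable_spinor_fun)+

lemma cinner_spinor_add_left:
  "cinner (\<Phi> + \<Psi>) X = cinner \<Phi> X + cinner \<Psi> X" for \<Phi> \<Psi> X :: spinor_field
proof -
  have "cinner (\<Phi> + \<Psi>) X
      = (\<integral>q. cdot (spinor_fun \<Phi> q) (spinor_fun X q) + cdot (spinor_fun \<Psi> q) (spinor_fun X q) \<partial>lebesgue)"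
    unfolding cinner_spinor_field_def
  proof (rule integral_cong_AE)
    show "AE q in lebesgue. cdot (spinor_fun (\<Phi> + \<Psi>) q) (spinor_fun X q)
        = cdot (spinor_fun \<Phi> q) (spinor_fun X q) + cdot (spinor_fun \<Psi> q) (spinor_fun X q)"
      using AE_spinor_fun(2)[of \<Phi> \<Psi>] by eventually_elim (simp add: cdot_add_left)
  qed measurable
  then show ?thesis
    by (simp add: cinner_spinor_field_def integrable_cdot square_integrable_spinor_fun)
qed

lemma cinner_spinor_scaleC_left:
  "cinner (c *\<^sub>C \<Phi>) \<Psi> = c * cinner \<Phi> \<Psi>" for \<Phi> \<Psi> :: spinor_field
proof -
  have "cinner (c *\<^sub>C \<Phi>) \<Psi> = (\<integral>q. c * cdot (spinor_fun \<Phi> q) (spinor_fun \<Psi> q) \<partial>lebesgue)"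
    unfolding cinner_spinor_field_def
  proof (rule integral_cong_AE)
    show "AE q in lebesgue. cdot (spinor_fun (c *\<^sub>C \<Phi>) q) (spinor_fun \<Psi> q)
        = c * cdot (spinor_fun \<Phi> q) (spinor_fun \<Psi> q)"
      using AE_spinor_fun(6)[of c \<Phi>] by eventually_elim (simp add: cdot_scaleC_left)
  qed measurable
  then show ?thesis by (simp add: cinner_spinor_field_def)
qed

lemma cinner_spinor_commute: "cinner \<Phi> \<Psi> = cnj (cinner \<Psi> \<Phi>)" for \<Phi> \<Psi> :: spinor_field
  unfolding cinner_spinor_field_def
  by (subst cdot_commute) (simp add: integral_cnj)

lemma Re_cinner_spinor: "Re (cinner \<Phi> \<Psi>) = inner \<Phi> \<Psi>" for \<Phi> \<Psi> :: spinor_field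
  unfolding cinner_spinor_field_def inner_spinor_field_def
  by (subst integral_Re[symmetric])
     (simp_all add: Re_cdot integrable_cdot square_integrable_spinor_fun)

lemma scaleR_spinor_scaleC: "r *\<^sub>R \<Phi> = complex_of_real r *\<^sub>C \<Phi>" for \<Phi> :: spinor_field
  by (simp add: scaleR_spinor_field_def scaleC_spinor_field_def scaleR_eq_scaleC)

lemma inner_spinor_ge_0: "0 \<le> inner \<Phi> \<Phi>" for \<Phi> :: spinor_field
  unfolding inner_spinor_field_def by (rule integral_nonneg_AE) simp

lemma inner_spinor_eq_0: "inner \<Phi> \<Phi> = 0 \<longleftrightarrow> \<Phi> = 0" for \<Phi> :: spinor_field
proof -
  have "inner \<Phi> \<Phi> = 0 \<longleftrightarrow> (AE q in lebesgue. inner (spinor_fun \<Phi> q) (spinor_fun \<Phi> q) = 0)"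
    unfolding inner_spinor_field_def
    by (rule integral_nonneg_eq_0_iff_AE)
       (simp_all add: integrable_inner square_integrable_spinor_fun)
  also have "\<dots> \<longleftrightarrow> (AE q in lebesgue. spinor_fun \<Phi> q = spinor_fun 0 q)"
    using AE_spinor_fun(1) by (auto elim: AE_mp)
  also have "\<dots> \<longleftrightarrow> \<Phi> = 0"
    by (auto intro: spinor_eqI)
  finally show ?thesis .
qed

instance
proof
  fix \<Phi> \<Psi> X :: spinor_field and r s :: real and c d :: complex
  show "\<Phi> + \<Psi> + X = \<Phi> + (\<Psi> + X)"
    apply (rule spinor_eqI)
    using AE_spinor_fun(2)[of "\<Phi> + \<Psi>" X] AE_spinor_fun(2)[of \<Phi> \<Psi>]
      AE_spinor_fun(2)[of \<Phi> "\<Psi> + X"] AE_spinor_fun(2)[of \<Psi> X]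
    by eventually_elim simp
  show "\<Phi> + \<Psi> = \<Psi> + \<Phi>"
    by (simp add: plus_spinor_field_def add.commute)
  show "0 + \<Phi> = \<Phi>"
    apply (rule spinor_eqI)
    using AE_spinor_fun(1) AE_spinor_fun(2)[of 0 \<Phi>] by eventually_elim simp
  show "- \<Phi> + \<Phi> = 0"
    apply (rule spinor_eqI)
    using AE_spinor_fun(1) AE_spinor_fun(2)[of "- \<Phi>" \<Phi>] AE_spinor_fun(4)[of \<Phi>]
    by eventually_elim simp
  show "\<Phi> - \<Psi> = \<Phi> + - \<Psi>"
    apply (rule spinor_eqI)
    using AE_spinor_fun(3)[of \<Phi> \<Psi>] AE_spinor_fun(2)[of \<Phi> "- \<Psi>"] AE_spinor_fun(4)[of \<Psi>]
    by eventually_elim simp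
  show add_right: "c *\<^sub>C (\<Phi> + \<Psi>) = c *\<^sub>C \<Phi> + c *\<^sub>C \<Psi>" for c
    apply (rule spinor_eqI)
    using AE_spinor_fun(6)[of c "\<Phi> + \<Psi>"] AE_spinor_fun(2)[of \<Phi> \<Psi>]
      AE_spinor_fun(2)[of "c *\<^sub>C \<Phi>" "c *\<^sub>C \<Psi>"] AE_spinor_fun(6)[of c \<Phi>] AE_spinor_fun(6)[of c \<Psi>]
    by eventually_elim (simp add: vec_eq_iff algebra_simps)
  show add_left: "(c + d) *\<^sub>C \<Phi> = c *\<^sub>C \<Phi> + d *\<^sub>C \<Phi>" for c d
    apply (rule spinor_eqI)
    using AE_spinor_fun(6)[of "c + d" \<Phi>] AE_spinor_fun(2)[of "c *\<^sub>C \<Phi>" "d *\<^sub>C \<Phi>"]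
      AE_spinor_fun(6)[of c \<Phi>] AE_spinor_fun(6)[of d \<Phi>]
    by eventually_elim (simp add: vec_eq_iff algebra_simps)
  show assoc: "c *\<^sub>C d *\<^sub>C \<Phi> = (c * d) *\<^sub>C \<Phi>" for c d
    apply (rule spinor_eqI)
    using AE_spinor_fun(6)[of c "d *\<^sub>C \<Phi>"] AE_spinor_fun(6)[of d \<Phi>] AE_spinor_fun(6)[of "c * d" \<Phi>]
    by eventually_elim (simp add: vec_eq_iff algebra_simps)
  show "complex_of_real r *\<^sub>C \<Phi> = r *\<^sub>R \<Phi>"
    by (simp add: scaleR_spinor_scaleC)
  show "r *\<^sub>R (\<Phi> + \<Psi>) = r *\<^sub>R \<Phi> + r *\<^sub>R \<Psi>"
    by (simp add: scaleR_spinor_scaleC add_right)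
  show "(r + s) *\<^sub>R \<Phi> = r *\<^sub>R \<Phi> + s *\<^sub>R \<Phi>"
    by (simp add: scaleR_spinor_scaleC add_left)
  show "r *\<^sub>R s *\<^sub>R \<Phi> = (r * s) *\<^sub>R \<Phi>"
    by (simp add: scaleR_spinor_scaleC assoc)
  show "1 *\<^sub>R \<Phi> = \<Phi>"
    apply (rule spinor_eqI)
    using AE_spinor_fun(5)[of 1 \<Phi>] by eventually_elim simp
  show "cinner \<Phi> \<Psi> = cnj (cinner \<Psi> \<Phi>)"
    by (rule cinner_spinor_commute)
  show "cinner (\<Phi> + \<Psi>) X = cinner \<Phi> X + cinner \<Psi> X"
    by (rule cinner_spinor_add_left)
  show "cinner (c *\<^sub>C \<Phi>) \<Psi> = c * cinner \<Phi> \<Psi>"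
    by (rule cinner_spinor_scaleC_left)
  show "Re (cinner \<Phi> \<Psi>) = inner \<Phi> \<Psi>"
    by (rule Re_cinner_spinor)
  show "inner \<Phi> \<Psi> = inner \<Psi> \<Phi>"
    by (simp add: inner_spinor_field_def inner_commute)
  show "inner (\<Phi> + \<Psi>) X = inner \<Phi> X + inner \<Psi> X"
    by (simp flip: Re_cinner_spinor add: cinner_spinor_add_left)
  show "inner (r *\<^sub>R \<Phi>) \<Psi> = r * inner \<Phi> \<Psi>"
    by (simp flip: Re_cinner_spinor add: scaleR_spinor_scaleC cinner_spinor_scaleC_left)
  show "0 \<le> inner \<Phi> \<Phi>"
    by (rule inner_spinor_ge_0)
  show "inner \<Phi> \<Phi> = 0 \<longleftrightarrow> \<Phi> = 0"
    by (rule inner_spinor_eq_0)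
qed (simp_all only: norm_spinor_field_def sgn_spinor_field_def dist_spinor_field_def
      uniformity_spinor_field_def open_spinor_field_def)

end

lemma nn_integral_norm_spinor:
  "(\<integral>\<^sup>+q. ennreal ((norm (spinor_fun \<Phi> q))\<^sup>2) \<partial>lebesgue) = ennreal ((norm \<Phi>)\<^sup>2)"
proof -
  have "(\<integral>\<^sup>+q. ennreal ((norm (spinor_fun \<Phi> q))\<^sup>2) \<partial>lebesgue)
      = ennreal (\<integral>q. (norm (spinor_fun \<Phi> q))\<^sup>2 \<partial>lebesgue)"
    using square_integrable_spinor_fun[of \<Phi>]
    by (intro nn_integral_eq_integral) (auto simp: square_integrable_def)
  then show ?thesis
    by (simp add: power2_norm_eq_inner inner_spinor_field_def)
qed

instance spinor_field :: chilbert_space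
proof
  fix X :: "nat \<Rightarrow> spinor_field"
  assume X: "Cauchy X"
  have "\<forall>k. \<exists>N. \<forall>m\<ge>N. \<forall>n\<ge>N. norm (X m - X n) < (1/2)^k"
    using X unfolding Cauchy_def dist_norm by (metis zero_less_power half_gt_zero_iff zero_less_one)
  then obtain N where N: "\<And>k m n. m \<ge> N k \<Longrightarrow> n \<ge> N k \<Longrightarrow> norm (X m - X n) < (1/2)^k"
    by metis
  define r where "r = rec_nat (N 0) (\<lambda>k rk. max (Suc rk) (N (Suc k)))"
  have r_Suc: "r (Suc k) = max (Suc (r k)) (N (Suc k))" for k
    by (simp add: r_def)
  have rN: "r k \<ge> N k" for k
    by (cases k) (simp_all add: r_def)
  have mono: "strict_mono r"
    by (rule strict_monoI_Suc) (simp add: r_Suc less_Suc_eq_le)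
  have r_le: "i \<le> j \<Longrightarrow> r i \<le> r j" for i j
    using mono by (simp add: strict_mono_less_eq)
  define Y where "Y = X \<circ> r"
  have Y: "norm (Y j - Y k) < (1/2)^k" if "k \<le> j" for j k
    unfolding Y_def comp_def by (rule N) (use rN[of k] r_le[OF that] in auto)
  define d where "d k q = norm (spinor_fun (Y (Suc k)) q - spinor_fun (Y k) q)" for k q
  have [measurable]: "d k \<in> borel_measurable lebesgue" for k
    unfolding d_def by measurable
  have nnd: "(\<integral>\<^sup>+q. ennreal ((norm (spinor_fun \<Phi> q - spinor_fun \<Psi> q))\<^sup>2) \<partial>lebesgue)
      = ennreal ((norm (\<Phi> - \<Psi>))\<^sup>2)" for \<Phi> \<Psi>
  proof -
    have "(\<integral>\<^sup>+q. ennreal ((norm (spinor_fun \<Phi> q - spinor_fun \<Psi> q))\<^sup>2) \<partial>lebesgue)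
      = (\<integral>\<^sup>+q. ennreal ((norm (spinor_fun (\<Phi> - \<Psi>) q))\<^sup>2) \<partial>lebesgue)"
      by (rule nn_integral_cong_AE) (use AE_spinor_fun(3)[of \<Phi> \<Psi>] in \<open>eventually_elim, simp\<close>)
    then show ?thesis by (simp add: nn_integral_norm_spinor)
  qed
  have "(\<integral>\<^sup>+q. (\<Sum>k. ennreal (2^k * (d k q)\<^sup>2)) \<partial>lebesgue)
      = (\<Sum>k. \<integral>\<^sup>+q. ennreal (2^k * (d k q)\<^sup>2) \<partial>lebesgue)"
    by (rule nn_integral_suminf) measurable
  also have "\<dots> \<le> (\<Sum>k. ennreal ((1/2)^k))"
  proof (rule suminf_le)
    fix k
    have "(\<integral>\<^sup>+q. ennreal (2^k * (d k q)\<^sup>2) \<partial>lebesgue)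
        = ennreal (2^k) * (\<integral>\<^sup>+q. ennreal ((d k q)\<^sup>2) \<partial>lebesgue)"
      by (subst nn_integral_cmult[symmetric]) (simp_all add: ennreal_mult)
    also have "\<dots> = ennreal (2^k * (norm (Y (Suc k) - Y k))\<^sup>2)"
      unfolding d_def nnd by (simp add: ennreal_mult)
    also have "\<dots> \<le> ennreal (2^k * ((1/2)^k)\<^sup>2)"
      using Y[of k "Suc k"] by (intro ennreal_leI mult_left_mono power_mono) auto
    also have "(2::real)^k * ((1/2)^k)\<^sup>2 = (1/2)^k"
      by (simp add: power2_eq_square power_one_over field_simps)
    finally show "(\<integral>\<^sup>+q. ennreal (2^k * (d k q)\<^sup>2) \<partial>lebesgue) \<le> ennreal ((1/2)^k)" .
  qed simp_all
  also have "\<dots> < \<infinity>"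
    by (subst suminf_ennreal2) (simp_all add: summable_geometric)
  finally have "(\<integral>\<^sup>+q. (\<Sum>k. ennreal (2^k * (d k q)\<^sup>2)) \<partial>lebesgue) \<noteq> \<infinity>"
    by simp
  then have fin: "AE q in lebesgue. (\<Sum>k. ennreal (2^k * (d k q)\<^sup>2)) \<noteq> \<infinity>"
    by (rule nn_integral_PInf_AE[rotated]) measurable
  have conv: "convergent (\<lambda>k. spinor_fun (Y k) q)"
    if "(\<Sum>k. ennreal (2^k * (d k q)\<^sup>2)) \<noteq> \<infinity>" for q
  proof -
    have "summable (\<lambda>k. 2^k * (d k q)\<^sup>2)"
      using that by (intro summable_suminf_not_top) auto
    then have "(\<lambda>k. 2^k * (d k q)\<^sup>2) \<longlonglongrightarrow> 0"
      by (rule summable_LIMSEQ_zero)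
    then have "Bseq (\<lambda>k. 2^k * (d k q)\<^sup>2)"
      by (intro convergent_imp_Bseq convergentI)
    then obtain C where C: "C > 0" "\<And>k. norm (2^k * (d k q)\<^sup>2) \<le> C"
      by (rule BseqE) auto
    have le: "d k q \<le> sqrt C * sqrt (1/2)^k" for k
    proof -
      have "2^k * (d k q)\<^sup>2 \<le> C" using C(2)[of k] by simp
      then have "(d k q)\<^sup>2 \<le> C * (1/2)^k"
        by (simp add: power_one_over field_simps)
      then have "d k q \<le> sqrt (C * (1/2)^k)"
        by (rule real_le_rsqrt)
      then show ?thesis by (simp only: real_sqrt_mult real_sqrt_power)
    qed
    have "summable (\<lambda>k. sqrt C * sqrt (1/2)^k)"
      by (intro summable_mult summable_geometric) (simp add: real_sqrt_divide)
    then have "summable (\<lambda>k. norm (spinor_fun (Y (Suc k)) q - spinor_fun (Y k) q))"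
      by (rule summable_comparison_test') (use le in \<open>auto simp: d_def\<close>)
    then have "summable (\<lambda>k. spinor_fun (Y (Suc k)) q - spinor_fun (Y k) q)"
      by (rule summable_norm_cancel)
    then have "convergent (\<lambda>n. \<Sum>k<n. spinor_fun (Y (Suc k)) q - spinor_fun (Y k) q)"
      by (simp add: summable_iff_convergent)
    then have "convergent (\<lambda>n. spinor_fun (Y n) q - spinor_fun (Y 0) q)"
      by (simp only: sum_lessThan_telescope[of "\<lambda>k. spinor_fun (Y k) q"])
    then show ?thesis by (simp add: convergent_diff_const_right_iff)
  qed
  define f where "f q = lim (\<lambda>k. spinor_fun (Y k) q)" for q
  have f_meas [measurable]: "f \<in> borel_measurable lebesgue"
    unfolding f_def by (rule borel_measurable_lim_metric) measurable
  have limf: "AE q in lebesgue. (\<lambda>k. spinor_fun (Y k) q) \<longlonglongrightarrow> f q"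
    using fin by eventually_elim (use conv in \<open>auto simp: f_def convergent_LIMSEQ_iff\<close>)
  have fatou: "(\<integral>\<^sup>+q. ennreal ((norm (f q - spinor_fun (Y k) q))\<^sup>2) \<partial>lebesgue) \<le> ennreal (((1/2)^k)\<^sup>2)" for k
  proof -
    have "(\<integral>\<^sup>+q. ennreal ((norm (f q - spinor_fun (Y k) q))\<^sup>2) \<partial>lebesgue)
        = (\<integral>\<^sup>+q. liminf (\<lambda>j. ennreal ((norm (spinor_fun (Y j) q - spinor_fun (Y k) q))\<^sup>2)) \<partial>lebesgue)"
    proof (rule nn_integral_cong_AE, use limf in eventually_elim)
      fix q assume "(\<lambda>j. spinor_fun (Y j) q) \<longlonglongrightarrow> f q"
      then have "(\<lambda>j. ennreal ((norm (spinor_fun (Y j) q - spinor_fun (Y k) q))\<^sup>2))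
          \<longlonglongrightarrow> ennreal ((norm (f q - spinor_fun (Y k) q))\<^sup>2)"
        by (intro tendsto_ennrealI tendsto_intros)
      then show "ennreal ((norm (f q - spinor_fun (Y k) q))\<^sup>2)
          = liminf (\<lambda>j. ennreal ((norm (spinor_fun (Y j) q - spinor_fun (Y k) q))\<^sup>2))"
        using lim_imp_Liminf[OF sequentially_bot] by metis
    qed
    also have "\<dots> \<le> liminf (\<lambda>j. \<integral>\<^sup>+q. ennreal ((norm (spinor_fun (Y j) q - spinor_fun (Y k) q))\<^sup>2) \<partial>lebesgue)"
      by (rule nn_integral_liminf) measurable
    also have "\<dots> \<le> liminf (\<lambda>j. ennreal (((1/2)^k)\<^sup>2))"
    proof (rule Liminf_mono)
      show "\<forall>\<^sub>F j in sequentially.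
          (\<integral>\<^sup>+q. ennreal ((norm (spinor_fun (Y j) q - spinor_fun (Y k) q))\<^sup>2) \<partial>lebesgue)
          \<le> ennreal (((1/2)^k)\<^sup>2)"
        unfolding nnd using eventually_ge_at_top[of k]
        by eventually_elim (intro ennreal_leI power_mono less_imp_le[OF Y] norm_ge_zero)
    qed
    also have "\<dots> = ennreal (((1/2)^k)\<^sup>2)"
      by (simp add: Liminf_const)
    finally show ?thesis .
  qed
  have "square_integrable (\<lambda>q. f q - spinor_fun (Y 0) q)"
    using fatou[of 0]
    by (auto simp: square_integrable_def integrable_iff_bounded intro: le_less_trans)
  then have "square_integrable (\<lambda>q. (f q - spinor_fun (Y 0) q) + spinor_fun (Y 0) q)"
    by (intro square_integrable_add square_integrable_spinor_fun)
  then have sq: "square_integrable f" by simp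
  have bound: "norm (mk_spinor f - Y k) \<le> (1/2)^k" for k
  proof -
    have "ennreal ((norm (mk_spinor f - Y k))\<^sup>2)
        = (\<integral>\<^sup>+q. ennreal ((norm (f q - spinor_fun (Y k) q))\<^sup>2) \<partial>lebesgue)"
      unfolding nnd[symmetric]
      by (rule nn_integral_cong_AE) (use spinor_fun_mk[OF sq] in \<open>eventually_elim, simp\<close>)
    also have "\<dots> \<le> ennreal (((1/2)^k)\<^sup>2)"
      by (rule fatou)
    finally have "(norm (mk_spinor f - Y k))\<^sup>2 \<le> ((1/2)^k)\<^sup>2"
      by simp
    then show ?thesis
      by (rule power2_le_imp_le) simp
  qed
  have "(\<lambda>k. Y k - mk_spinor f) \<longlonglongrightarrow> 0"
  proof (rule Lim_null_comparison)
    show "\<forall>\<^sub>F k in sequentially. norm (Y k - mk_spinor f) \<le> (1/2)^k"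
      using bound by (simp add: norm_minus_commute)
    show "(\<lambda>k. (1/2)^k :: real) \<longlonglongrightarrow> 0"
      by (rule LIMSEQ_power_zero) simp
  qed
  then have "Y \<longlonglongrightarrow> mk_spinor f"
    by (simp add: LIM_zero_iff)
  then have "X \<longlonglongrightarrow> mk_spinor f"
    unfolding Y_def by (rule Cauchy_converges_subseq[OF X mono])
  then show "convergent X"
    by (rule convergentI)
qed

section \<open>The Dirac operator in the momentum representation\<close>

definition dirac_symbol :: "real \<Rightarrow> real^3 \<Rightarrow> complex^4^4" where
  "dirac_symbol m q =
     (let q1 = complex_of_real (q$1); q2 = complex_of_real (q$2); q3 = complex_of_real (q$3);
          \<mu> = complex_of_real m in
      vector [vector [\<mu>, 0, q3, q1 - \<i> * q2],
              vector [0, \<mu>, q1 + \<i> * q2, - q3],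
              vector [q3, q1 - \<i> * q2, - \<mu>, 0],
              vector [q1 + \<i> * q2, - q3, 0, - \<mu>]])"

text \<open>Multiplication by \<open>H(q)\<close> on its maximal domain, on which it is self-adjoint.\<close>

definition free_dirac :: "real \<Rightarrow> (spinor_field \<rightharpoonup> spinor_field)" where
  "free_dirac m \<Phi> =
     (let f = (\<lambda>q. dirac_symbol m q *v spinor_fun \<Phi> q) in
      if square_integrable f then Some (mk_spinor f) else None)"

text \<open>The domain of the perturbed operator is left open; on it the integral converges absolutely
  for almost every \<open>q\<close>.\<close>

definition perturbed_dirac ::
  "real \<Rightarrow> (real^3 \<Rightarrow> real^3 \<Rightarrow> complex^4^4) \<Rightarrow> (spinor_field \<rightharpoonup> spinor_field) \<Rightarrow> bool" where
  "perturbed_dirac m U A \<longleftrightarrow>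
     (\<forall>\<Phi> \<Psi>. A \<Phi> = Some \<Psi> \<longrightarrow>
       (AE q in lebesgue. integrable lebesgue (\<lambda>r. U q r *v spinor_fun \<Phi> r) \<and>
          spinor_fun \<Psi> q =
            dirac_symbol m q *v spinor_fun \<Phi> q + (\<integral>r. U q r *v spinor_fun \<Phi> r \<partial>lebesgue)))"

text \<open>On \<open>D\<close> the operator \<open>T\<close> acts as \<open>(T \<Phi>)(q) = M(q) \<Phi>(q)\<close>.\<close>

definition matrix_function_of ::
  "spinor_field set \<Rightarrow> (spinor_field \<Rightarrow> spinor_field) \<Rightarrow> (real^3 \<Rightarrow> complex^4^4) \<Rightarrow> bool" where
  "matrix_function_of D T M \<longleftrightarrow>
     (\<forall>\<Phi>\<in>D. AE q in lebesgue. spinor_fun (T \<Phi>) q = M q *v spinor_fun \<Phi> q)"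

definition dirac_energy :: "real \<Rightarrow> real^3 \<Rightarrow> real" where
  "dirac_energy m q = sqrt (m\<^sup>2 + ((q$1)\<^sup>2 + (q$2)\<^sup>2 + (q$3)\<^sup>2))"

text \<open>The denominator \<open>m - dirac_energy m q\<close> of the vectors with \<open>k = 3, 4\<close> vanishes at \<open>q = 0\<close>. These vectors
  are meaningful for \<open>q \<noteq> 0\<close> only, i.e. almost everywhere.\<close>

definition dirac_eigenvector :: "real \<Rightarrow> nat \<Rightarrow> real^3 \<Rightarrow> complex^4" where
  "dirac_eigenvector m k q =
     (let q1 = complex_of_real (q$1); q2 = complex_of_real (q$2); q3 = complex_of_real (q$3);
          \<mu> = complex_of_real m; l3 = complex_of_real (dirac_energy m q) in
      if k = 1 then vector [(- q1 + \<i> * q2) / (\<mu> + l3), q3 / (\<mu> + l3), 0, 1]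
      else if k = 2 then vector [- q3 / (\<mu> + l3), (- q1 - \<i> * q2) / (\<mu> + l3), 1, 0]
      else if k = 3 then vector [(- q1 + \<i> * q2) / (\<mu> - l3), q3 / (\<mu> - l3), 0, 1]
      else vector [- q3 / (\<mu> - l3), (- q1 - \<i> * q2) / (\<mu> - l3), 1, 0])"

text \<open>\<open>vec.span\<close> is the span over the field \<open>\<complex>\<close>.\<close>

definition dirac_eigenspace :: "real \<Rightarrow> nat \<Rightarrow> real^3 \<Rightarrow> (complex^4) set" where
  "dirac_eigenspace m n q =
     (if n = 1 then vec.span {dirac_eigenvector m 1 q, dirac_eigenvector m 2 q}
      else vec.span {dirac_eigenvector m 3 q, dirac_eigenvector m 4 q})"

definition orth_projector :: "(complex^'n) set \<Rightarrow> complex^'n^'n" where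
  "orth_projector M = (THE P. \<forall>v. P *v v \<in> M \<and> (\<forall>w\<in>M. cdot (v - P *v v) w = 0))"

definition dirac_projector :: "real \<Rightarrow> nat \<Rightarrow> real^3 \<Rightarrow> complex^4^4" where
  "dirac_projector m n q = orth_projector (dirac_eigenspace m n q)"

end

theory Submission
  imports Defs
begin

text \<open>An operator that commutes with \<open>A\<^sub>0\<close> and acts as multiplication by a matrix function commutes
  with \<open>H(q)\<close> for almost every \<open>q\<close>, hence with the projectors onto the two eigenspaces of \<open>H(q)\<close>,
  which gives the block structure. The deviation factor commutes with \<open>A\<^sub>0\<close> on \<open>G\<^sub>0\<close>, and \<open>G\<^sub>0\<close> is the
  whole space because the energy pushes Lebesgue measure forward to an absolutely continuous measure.
  The scattering operator commutes with \<open>A\<^sub>0\<close> because of the intertwining relation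
  \<open>exp(i\<tau>A) W\<^sub>\<plusminus> = W\<^sub>\<plusminus> exp(i\<tau>A\<^sub>0)\<close>; the slow variation \<open>W\<^sub>0(t+\<tau>) W\<^sub>0(t)\<^sup>-\<^sup>1 \<rightarrow> 1\<close> of the deviation
  factor and the uniform boundedness principle make the usual proof work for generalized wave
  operators.\<close>

section \<open>Operators in a complex Hilbert space\<close>

text \<open>The matrix \<open>H = dirac_symbol m q\<close> is hermitian and its square is the scalar
  \<lambda>^2, where \<lambda> = \<open>dirac_energy m q\<close>, so its spectral projectors are (1
  + s H/\<lambda>)/2 with s = 1 and s = -1. This closed form is regular also at q = 0, where g_3 and
  g_4 are singular; the spans of the g_k enter only when it is identified with
  \<open>dirac_projector\<close> for q \<noteq> 0. \<open>ac_subspace\<close> asks for a spectral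
  measure, so one is constructed: E(B) multiplies by the sum of those projectors whose eigenvalue
  lies in B. The vector measure of \<Phi> is then the sum of two push-forwards, under -\<lambda> and
  \<lambda>, of weights |P \<Phi>|^2 dq. The groups exp(i t A) and exp(i t A0) are given only
  through their generators; isometry and commutation relations both come from conservation of the
  norm along solutions of z' = i A z. Uniform boundedness is called for because the inverse of W0(t)
  is bounded for each t separately, with no bound uniform in t, while the limit is taken at an
  argument W0(t) W0(t + \<tau>)^-1 f that moves with t.\<close>

lemma norm_scaleC: "norm (c *\<^sub>C x) = cmod c * norm (x::'h::complex_inner)"
proof -
  have "cinner (c *\<^sub>C x) (c *\<^sub>C x) = c * cnj (c * cinner x x)"
    by (metis cinner_commute cinner_scaleC_left)
  moreover have "cnj (cinner x x) = cinner x x"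
    by (metis cinner_commute)
  ultimately have "cinner (c *\<^sub>C x) (c *\<^sub>C x) = complex_of_real ((cmod c)\<^sup>2) * cinner x x"
    by (simp only: complex_norm_square complex_cnj_mult mult.assoc)
  then have "Re (cinner (c *\<^sub>C x) (c *\<^sub>C x)) = (cmod c)\<^sup>2 * Re (cinner x x)"
    by simp
  then have "(norm (c *\<^sub>C x))\<^sup>2 = (cmod c * norm x)\<^sup>2"
    by (simp only: Re_cinner power2_norm_eq_inner power_mult_distrib)
  then show ?thesis by simp
qed

lemma bounded_linear_scaleC_op: "bounded_linear (\<lambda>x::'h::complex_inner. c *\<^sub>C x)"
proof (rule bounded_linear_intro[where K = "cmod c"])
  fix r :: real and x :: 'h
  show "c *\<^sub>C r *\<^sub>R x = r *\<^sub>R c *\<^sub>C x"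
    by (simp flip: scaleC_of_real add: scaleC_scaleC mult.commute)
qed (simp_all add: scaleC_add_right norm_scaleC)

lemma cinner_add_right: "cinner x (y + z) = cinner x y + cinner x (z::'h::complex_inner)"
  by (metis cinner_add_left cinner_commute complex_cnj_add)

lemma cinner_scaleC_right: "cinner x (c *\<^sub>C y) = cnj c * cinner x (y::'h::complex_inner)"
  by (metis cinner_commute cinner_scaleC_left complex_cnj_mult)

text \<open>Since Im z = Re (- i z), the complex inner product is recovered from the real one. A
  complex linear map that preserves \<open>inner\<close> therefore preserves
  \<open>cinner\<close>.\<close>

lemma cinner_inner: "cinner x y = Complex (inner x y) (inner ((- \<i>) *\<^sub>C x) (y::'h::complex_inner))"
  by (simp add: complex_eq_iff cinner_scaleC_left flip: Re_cinner)

lemma cinner_right_ext: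
  assumes "\<And>x. cinner x y = cinner x (z::'h::complex_inner)"
  shows "y = z"
proof -
  have "inner x y = inner x z" for x
    using assms[of x] by (metis Re_cinner)
  then show ?thesis
    by (metis inner_commute vector_eq_rdot)
qed

lemma bounded_clinear_on_imp_bounded_linear:
  "bounded_clinear_on UNIV T \<Longrightarrow> bounded_linear (T :: 'h::complex_inner \<Rightarrow> 'h)"
  unfolding bounded_clinear_on_def clinear_on_def
  by (metis UNIV_I bounded_linear_intro mult.commute scaleC_of_real)

lemma bounded_clinear_on_scaleC: "bounded_clinear_on UNIV T \<Longrightarrow> T (c *\<^sub>C x) = c *\<^sub>C T x"
  by (auto simp: bounded_clinear_on_def clinear_on_def)

lemma csubspace_UNIV: "csubspace UNIV"
  by (simp add: csubspace_def)

definition symmetric_operator :: "('h::complex_inner \<rightharpoonup> 'h) \<Rightarrow> bool" where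
  "symmetric_operator A \<longleftrightarrow> (\<forall>f g a b. A f = Some a \<longrightarrow> A g = Some b \<longrightarrow> cinner a g = cinner f b)"

text \<open>The value of \<open>adjoint_operator\<close> is chosen by \<open>THE\<close>, so it is
  known to satisfy the adjoint relation only after uniqueness is shown. This is where density of the
  domain enters: two candidates have the same inner products with a dense set.\<close>

lemma self_adjoint_imp_symmetric:
  assumes "self_adjoint A"
  shows "symmetric_operator A"
  unfolding symmetric_operator_def
proof (intro allI impI)
  fix f g a b assume A: "A f = Some a" "A g = Some b"
  have adj: "adjoint_operator A g = Some b" and dense: "closure (dom A) = UNIV"
    using assms A by (auto simp: self_adjoint_def)
  let ?P = "\<lambda>k. \<forall>f\<in>dom A. cinner (the (A f)) g = cinner f k"
  have ex: "\<exists>k. ?P k" and the: "b = (THE k. ?P k)"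
    using adj by (auto simp: adjoint_operator_def split: if_splits)
  then obtain k where k: "?P k" by blast
  have "k' = k" if k': "?P k'" for k'
  proof -
    have "closure (dom A) \<subseteq> {x. inner x k' = inner x k}"
    proof (rule closure_minimal)
      show "dom A \<subseteq> {x. inner x k' = inner x k}"
        using k k' by (metis (mono_tags, lifting) Re_cinner mem_Collect_eq subsetI)
      show "closed {x. inner x k' = inner x k}"
        by (intro closed_Collect_eq continuous_intros)
    qed
    then have "inner x k' = inner x k" for x
      using dense by auto
    then show "k' = k"
      by (metis inner_commute vector_eq_rdot)
  qed
  then have "(THE k. ?P k) = k"
    using k by (intro the_equality) auto
  then have "?P b" using k the by simp
  then show "cinner a g = cinner f b"
    using A by (auto simp: dom_def dest!: spec[of _ f])
qed

section \<open>Norm conservation and the groups generated by symmetric operators\<close>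

text \<open>The derivative of <z, z> is 2 Re <i A z, z>, and <A z, z> is real by symmetry. The lemma
  serves twice: for one orbit it gives isometry, for the difference of two orbits it gives
  uniqueness.\<close>

lemma symmetric_evolution_norm:
  assumes "symmetric_operator A"
    and z: "\<And>t. \<exists>w. A (z t) = Some w \<and> (z has_vector_derivative \<i> *\<^sub>C w) (at t)"
  shows "norm (z t) = norm (z 0)"
proof -
  have "((\<lambda>t. inner (z t) (z t)) has_real_derivative 0) (at t)" for t
  proof -
    obtain w where w: "A (z t) = Some w" "(z has_vector_derivative \<i> *\<^sub>C w) (at t)"
      using z by blast
    have "cinner w (z t) = cnj (cinner w (z t))"
      using assms(1) w(1) by (metis symmetric_operator_def cinner_commute)
    then have "Im (cinner w (z t)) = 0"
      by (simp add: complex_eq_iff)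
    then have 0: "inner (\<i> *\<^sub>C w) (z t) = 0"
      by (simp flip: Re_cinner add: cinner_scaleC_left)
    have "((\<lambda>t. inner (z t) (z t)) has_derivative
        (\<lambda>h. inner (z t) (h *\<^sub>R \<i> *\<^sub>C w) + inner (h *\<^sub>R \<i> *\<^sub>C w) (z t))) (at t)"
      by (intro has_derivative_inner) (use w in \<open>auto simp: has_vector_derivative_def\<close>)
    then show ?thesis
      using 0 by (simp add: has_field_derivative_def inner_commute[of "z t"] lambda_zero)
  qed
  then have "inner (z t) (z t) = inner (z 0) (z 0)"
    using DERIV_isconst_all by blast
  then show ?thesis by (simp add: norm_eq_sqrt_inner)
qed

lemma exp_i_group_bounded_linear: "exp_i_group A V \<Longrightarrow> bounded_linear (V t)"
  by (simp add: exp_i_group_def bounded_clinear_on_imp_bounded_linear)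

lemma exp_i_group_add: "exp_i_group A V \<Longrightarrow> V (s + t) f = V s (V t f)"
  by (simp add: exp_i_group_def)

lemma exp_i_group_0: "exp_i_group A V \<Longrightarrow> V 0 f = f"
  by (simp add: exp_i_group_def)

lemma exp_i_group_scaleC: "exp_i_group A V \<Longrightarrow> V t (c *\<^sub>C f) = c *\<^sub>C V t f"
  by (simp add: exp_i_group_def bounded_clinear_on_scaleC)

text \<open>\<open>exp_i_group\<close> speaks of the derivative at 0 only; the group law carries it
  to time t. Reading the orbit as \<open>V t (V s f)\<close> gives the derivative, reading it as
  \<open>V s (V t f)\<close> gives invariance of the domain.\<close>

lemma exp_i_group_generator:
  assumes V: "exp_i_group A V" and Af: "A f = Some g"
  shows "A (V t f) = Some (V t g)"
    and "((\<lambda>t. V t f) has_vector_derivative \<i> *\<^sub>C V t g) (at t)"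
proof -
  have d0: "((\<lambda>t. V t f) has_vector_derivative \<i> *\<^sub>C g) (at 0)"
    using assms by (simp add: exp_i_group_def)
  have d1: "((\<lambda>s. V t (V s f)) has_vector_derivative \<i> *\<^sub>C V t g) (at 0)"
    using bounded_linear.has_vector_derivative[OF exp_i_group_bounded_linear[OF V] d0]
    by (simp add: exp_i_group_scaleC[OF V])
  have "(\<lambda>s. V t (V s f)) = (\<lambda>s. V s (V t f))"
    by (simp flip: exp_i_group_add[OF V] add: add.commute)
  then show "A (V t f) = Some (V t g)"
    using d1 V by (simp add: exp_i_group_def)
  have "((\<lambda>s. V (t + s) f) has_vector_derivative \<i> *\<^sub>C V t g) (at 0)"
    using d1 by (simp add: exp_i_group_add[OF V])
  moreover have "((\<lambda>s. s - t) has_vector_derivative 1) (at t)"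
    by (auto intro!: derivative_eq_intros)
  ultimately show "((\<lambda>t. V t f) has_vector_derivative \<i> *\<^sub>C V t g) (at t)"
    using vector_diff_chain_at[of "\<lambda>s. s - t" 1 t "\<lambda>s. V (t + s) f"] by (simp add: comp_def)
qed

lemma bounded_linear_eq_on_dense:
  assumes "bounded_linear S" "bounded_linear T" "closure D = UNIV" "\<And>x. x \<in> D \<Longrightarrow> S x = T x"
  shows "S x = T x"
proof -
  have "closure D \<subseteq> {x. S x = T x}"
    using assms by (intro closure_minimal closed_Collect_eq linear_continuous_on) auto
  then show ?thesis using assms(3) by auto
qed

text \<open>Norm conservation on the domain extends by density, and polarization turns it into
  preservation of inner products. As \<open>V t\<close> and \<open>V (- t)\<close> are inverse to
  each other, the adjoint of \<open>V t\<close> is \<open>V (- t)\<close>.\<close>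

lemma exp_i_group_adjoint:
  assumes V: "exp_i_group A V" and "symmetric_operator A" "closure (dom A) = UNIV"
  shows "cinner (V t f) g = cinner f (V (- t) g)"
proof -
  note bl = exp_i_group_bounded_linear[OF V]
  have iso: "norm (V t f) = norm f" for t f
  proof -
    have "norm (V t f) = norm f" if "f \<in> dom A" for f
      using symmetric_evolution_norm[OF assms(2), of "\<lambda>t. V t f"] exp_i_group_generator[OF V] that
      by (auto simp: exp_i_group_0[OF V])
    then have "dom A \<subseteq> {f. norm (V t f) = norm f}" by blast
    then have "closure (dom A) \<subseteq> {f. norm (V t f) = norm f}"
      by (intro closure_minimal closed_Collect_eq continuous_intros linear_continuous_on bl)
    then show ?thesis using assms(3) by auto
  qed
  have inner: "inner (V t f) (V t g) = inner f g" for f g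
    using iso[of t "f + g"] iso[of t f] iso[of t g]
    by (simp add: dot_norm bounded_linear.linear[OF bl] linear_add)
  have "cinner (V t f) (V t g) = cinner f g" for f g
    unfolding cinner_inner by (simp add: inner flip: exp_i_group_scaleC[OF V])
  then show ?thesis
    using exp_i_group_add[OF V, of t "- t" g] by (metis add.right_inverse exp_i_group_0[OF V])
qed

text \<open>Both \<open>T V(t) f\<close> and \<open>V(t) T f\<close> solve \<open>z' = i A z\<close> with the same initial value.\<close>

lemma commutes_with_exp_i_group:
  assumes V: "exp_i_group A V" and A: "linear_operator A" "symmetric_operator A" "closure (dom A) = UNIV"
    and T: "bounded_clinear_on UNIV T" and TA: "\<And>f g. A f = Some g \<Longrightarrow> A (T f) = Some (T g)"
  shows "T (V t f) = V t (T f)"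
proof -
  note bl = exp_i_group_bounded_linear[OF V]
  note Tbl = bounded_clinear_on_imp_bounded_linear[OF T]
  have diff: "A (x - y) = Some (a - b)" if "A x = Some a" "A y = Some b" for x y a b
  proof -
    have cl: "clinear_on (dom A) (\<lambda>f. the (A f))"
      using A(1) by (simp add: linear_operator_def)
    have m: "(- 1) *\<^sub>C v = - v" for v :: 'a
      using scaleC_of_real[of "-1" v] by simp
    have xy: "x \<in> dom A" "y \<in> dom A" using that by auto
    then have "- y \<in> dom A" "the (A (- y)) = - b"
      using cl that(2) by (simp_all add: clinear_on_def csubspace_def flip: m)
    then have "x + - y \<in> dom A \<and> the (A (x + - y)) = a + - b"
      using cl xy that(1) unfolding clinear_on_def csubspace_def by (metis option.sel)
    then show ?thesis by auto
  qed
  have eq: "T (V t f) = V t (T f)" if f: "f \<in> dom A" for f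
  proof -
    obtain g where g: "A f = Some g" using f by blast
    \<comment> \<open>The norm of the difference is constant in time and is 0 at time 0. Vectors
      outside the domain are reached afterwards by density.\<close>
    define z where "z s = T (V s f) - V s (T f)" for s
    have "\<exists>w. A (z s) = Some w \<and> (z has_vector_derivative \<i> *\<^sub>C w) (at s)" for s
    proof (intro exI conjI)
      show "A (z s) = Some (T (V s g) - V s (T g))"
        unfolding z_def by (intro diff TA exp_i_group_generator[OF V] g)
      have "(z has_vector_derivative T (\<i> *\<^sub>C V s g) - \<i> *\<^sub>C V s (T g)) (at s)"
        unfolding z_def
        by (intro has_vector_derivative_diff bounded_linear.has_vector_derivative[OF Tbl]
            exp_i_group_generator(2)[OF V] TA g)
      then show "(z has_vector_derivative \<i> *\<^sub>C (T (V s g) - V s (T g))) (at s)"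
        by (simp add: bounded_clinear_on_scaleC[OF T]
            linear_diff[OF bounded_linear.linear[OF bounded_linear_scaleC_op]])
    qed
    from symmetric_evolution_norm[OF A(2) this] have "norm (z t) = norm (z 0)" .
    then show ?thesis by (simp add: z_def exp_i_group_0[OF V])
  qed
  show ?thesis
    by (rule bounded_linear_eq_on_dense[OF _ _ A(3) eq])
       (intro bounded_linear_compose[OF Tbl bl] bounded_linear_compose[OF bl Tbl])+
qed

text \<open>Converse of the preceding lemma: the domain of \<open>A\<close> consists exactly of the
  vectors whose orbit is differentiable at 0, and a bounded operator commuting with the group
  preserves this property and maps derivative to derivative.\<close>

lemma commutes_with_generator:
  assumes V: "exp_i_group A V" and T: "bounded_linear T" "\<And>c x. T (c *\<^sub>C x) = c *\<^sub>C T x"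
    and "\<And>t f. T (V t f) = V t (T f)" and Af: "A f = Some g"
  shows "A (T f) = Some (T g)"
proof -
  have "((\<lambda>t. V t f) has_vector_derivative \<i> *\<^sub>C g) (at 0)"
    using V Af by (simp add: exp_i_group_def)
  from bounded_linear.has_vector_derivative[OF T(1) this]
  have "((\<lambda>t. V t (T f)) has_vector_derivative \<i> *\<^sub>C T g) (at 0)"
    by (simp add: assms)
  then show ?thesis using V by (simp add: exp_i_group_def)
qed

section \<open>Uniform boundedness and strong limits\<close>

text \<open>Banach-Steinhaus by Baire category: the closed sets \<open>F k\<close> cover the space,
  so one of them contains a ball.\<close>

lemma uniform_boundedness:
  fixes T :: "nat \<Rightarrow> 'a::{real_normed_vector, complete_space} \<Rightarrow> 'b::real_normed_vector"
  assumes T: "\<And>n. bounded_linear (T n)" and lim: "\<And>x. \<exists>K. \<forall>n. norm (T n x) \<le> K"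
  shows "\<exists>K. \<forall>n x. norm (T n x) \<le> K * norm x"
proof -
  define F where "F k = {x. \<forall>n. norm (T n x) \<le> real k}" for k
  have closed: "closed (F k)" for k
  proof -
    have "F k = (\<Inter>n. {x. norm (T n x) \<le> real k})" by (auto simp: F_def)
    then show ?thesis
      by (simp add: closed_INT closed_Collect_le continuous_on_norm linear_continuous_on T)
  qed
  have "(\<Union>k. F k) = UNIV"
  proof -
    have "\<exists>k. x \<in> F k" for x
    proof -
      obtain K where "\<And>n. norm (T n x) \<le> K" using lim by blast
      moreover obtain k :: nat where "K \<le> real k" using real_arch_simple by blast
      ultimately show ?thesis by (auto simp: F_def intro: order_trans)
    qed
    then show ?thesis by blast
  qed
  moreover have "completely_metrizable_space (euclidean :: 'a topology)"
    by (rule completely_metrizable_space_euclidean)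
  ultimately have "\<exists>k. interior (F k) \<noteq> {}"
    using Baire_category_alt[of "euclidean :: 'a topology" "range F"] closed by fastforce
  then obtain k x0 where "x0 \<in> interior (F k)" by auto
  then obtain e where e: "e > 0" "cball x0 e \<subseteq> F k"
    using mem_interior_cball by blast
  \<comment> \<open>Rescaled to length \<open>e\<close>, the vector \<open>x\<close> is the
    difference of two points of the ball. The operators are bounded by \<open>k\<close> at both
    points, whence the factor 2.\<close>
  have "norm (T n x) \<le> (2 * real k / e) * norm x" for n x
  proof (cases "x = 0")
    case True
    then show ?thesis using linear_0[OF bounded_linear.linear[OF T[of n]]] by simp
  next
    case False
    interpret bounded_linear "T n" by (rule T)
    define y where "y = x0 + (e / norm x) *\<^sub>R x"
    have "y \<in> cball x0 e" "x0 \<in> cball x0 e"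
      using e False by (simp_all add: y_def dist_norm)
    then have "y \<in> F k" "x0 \<in> F k"
      using e(2) by blast+
    then have "norm (T n y) \<le> real k" "norm (T n x0) \<le> real k"
      by (simp_all add: F_def)
    then have "norm (T n y - T n x0) \<le> 2 * real k"
      by norm
    moreover have "T n y - T n x0 = (e / norm x) *\<^sub>R T n x"
      by (simp add: y_def add scaleR)
    ultimately have "(e / norm x) * norm (T n x) \<le> 2 * real k"
      using e by simp
    then show ?thesis using e False by (simp add: field_simps)
  qed
  then show ?thesis by blast
qed

text \<open>The moving argument is handled by T_n y_n - W x = T_n (y_n - x) + (T_n x - W x), where
  the first term needs a bound uniform in n. The family is a sequence because a convergent sequence
  is bounded, whereas a limit along \<open>at_top\<close> bounds the values only beyond a threshold
  that depends on the vector.\<close>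

lemma strong_limit:
  fixes T :: "nat \<Rightarrow> 'h::chilbert_space \<Rightarrow> 'h"
  assumes T: "\<And>n. bounded_clinear_on UNIV (T n)" and lim: "\<And>x. (\<lambda>n. T n x) \<longlonglongrightarrow> W x"
  shows "bounded_clinear_on UNIV W"
    and "y \<longlonglongrightarrow> x \<Longrightarrow> (\<lambda>n. T n (y n)) \<longlonglongrightarrow> W x"
proof -
  note bl = bounded_clinear_on_imp_bounded_linear[OF T]
  have "\<exists>K. \<forall>n. norm (T n x) \<le> K" for x
    using convergent_imp_Bseq[OF convergentI[OF lim[of x]]] by (auto simp: Bseq_def)
  then obtain K where K: "\<And>n x. norm (T n x) \<le> K * norm x"
    using uniform_boundedness[of T] bl by auto
  have add: "W (x + y) = W x + W y" for x y
    using LIMSEQ_unique[OF lim[of "x + y"]] tendsto_add[OF lim[of x] lim[of y]]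
    by (simp add: linear_add[OF bounded_linear.linear[OF bl]])
  have scale: "W (c *\<^sub>C x) = c *\<^sub>C W x" for c x
    using LIMSEQ_unique[OF lim[of "c *\<^sub>C x"]] bounded_linear.tendsto[OF bounded_linear_scaleC_op lim[of x]]
    by (simp add: bounded_clinear_on_scaleC[OF T])
  have "norm (W x) \<le> K * norm x" for x
    using Lim_bounded[OF tendsto_norm[OF lim[of x]]] K by blast
  then show "bounded_clinear_on UNIV W"
    by (auto simp: bounded_clinear_on_def clinear_on_def csubspace_UNIV add scale)
  assume y: "y \<longlonglongrightarrow> x"
  have "(\<lambda>n. T n (y n - x)) \<longlonglongrightarrow> 0"
  proof (rule Lim_null_comparison)
    show "\<forall>\<^sub>F n in sequentially. norm (T n (y n - x)) \<le> K * norm (y n - x)"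
      using K by simp
    have "(\<lambda>n. K * norm (y n - x)) \<longlonglongrightarrow> K * norm (x - x)"
      by (intro tendsto_intros y)
    then show "(\<lambda>n. K * norm (y n - x)) \<longlonglongrightarrow> 0" by simp
  qed
  from tendsto_add[OF this lim[of x]] show "(\<lambda>n. T n (y n)) \<longlonglongrightarrow> W x"
    by (simp add: linear_diff[OF bounded_linear.linear[OF bl]])
qed

section \<open>Intertwining by wave operators and commutation of the scattering operator with the
  free one\<close>

lemma bounded_clinear_on_compose:
  assumes "bounded_clinear_on UNIV S" "bounded_clinear_on UNIV T"
  shows "bounded_clinear_on UNIV (\<lambda>x. S (T x))"
proof -
  obtain K where "\<And>x. norm (S (T x)) \<le> K * norm x"
    using bounded_linear.bounded[OF bounded_linear_compose[OF assms[THEN bounded_clinear_on_imp_bounded_linear]]]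
    by (metis mult.commute)
  then show ?thesis
    using assms by (auto simp: bounded_clinear_on_def clinear_on_def)
qed

text \<open>Everything is evaluated along the sequence \<open>s\<close>. Since \<open>B (t)\<close> commutes with \<open>V0\<close>,
  \<open>V(t+\<tau>) V0(-t-\<tau>) B(t+\<tau>) V0(\<tau>) = V(\<tau>) (V(t) V0(-t) B(t)) (C(t) B(t+\<tau>))\<close>, where \<open>C(t)\<close> is the
  inverse of \<open>B(t)\<close>; the last factor tends to the identity.\<close>

lemma wave_operator_intertwines:
  fixes V V0 B C :: "real \<Rightarrow> 'h::chilbert_space \<Rightarrow> 'h"
  assumes V: "exp_i_group A V" and V0: "exp_i_group A0 V0"
    and B: "\<And>t. R < \<bar>t\<bar> \<Longrightarrow> bounded_clinear_on UNIV (B t)"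
    and inv: "\<And>t f. R < \<bar>t\<bar> \<Longrightarrow> B t (C t f) = f"
    and com: "\<And>t \<tau> f. R < \<bar>t\<bar> \<Longrightarrow> B t (V0 \<tau> f) = V0 \<tau> (B t f)"
    and slow: "\<And>\<tau> f. ((\<lambda>t. C (t + \<tau>) (B t f)) \<longlongrightarrow> f) F"
    and W: "\<And>f. ((\<lambda>t. V t (V0 (- t) (B t f))) \<longlongrightarrow> W f) F"
    and s: "\<And>\<tau>. filterlim (\<lambda>n. s n + \<tau>) F sequentially" "filterlim (\<lambda>n. \<bar>s n\<bar>) at_top sequentially"
  shows "bounded_clinear_on UNIV W" and "V \<tau> (W f) = W (V0 \<tau> f)"
proof -
  define T where "T t f = V t (V0 (- t) (B t f))" for t f
  have Tb: "bounded_clinear_on UNIV (T t)" if "R < \<bar>t\<bar>" for t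
    unfolding T_def using V V0
    by (intro bounded_clinear_on_compose[of "V t", OF _ bounded_clinear_on_compose[OF _ B[OF that]]])
       (auto simp: exp_i_group_def)
  have "\<forall>\<^sub>F n in sequentially. R + \<bar>\<tau>\<bar> < \<bar>s n\<bar>"
    using s(2) by (auto simp: filterlim_at_top_dense)
  then obtain N where N: "\<And>n. n \<ge> N \<Longrightarrow> R + \<bar>\<tau>\<bar> < \<bar>s n\<bar>"
    by (auto simp: eventually_sequentially)
  \<comment> \<open>Dropping the first \<open>N\<close> terms keeps both \<open>r n\<close> and
    \<open>r n + \<tau>\<close> outside [-R, R] for every n, as \<open>strong_limit\<close> and the
    commutation rule require.\<close>
  define r where "r n = s (n + N)" for n
  have r: "R < \<bar>r n\<bar>" "R < \<bar>r n + \<tau>\<bar>" for n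
    using N[of "n + N"] by (auto simp: r_def)
  have rF: "filterlim (\<lambda>n. r n + c) F sequentially" for c
    unfolding r_def using filterlim_compose[OF s(1) filterlim_add_const_nat_at_top] .
  have lim: "(\<lambda>n. T (r n) f) \<longlonglongrightarrow> W f" for f
    using filterlim_compose[OF W rF[of 0]] by (simp add: T_def)
  note sl = strong_limit[OF Tb[OF r(1)] lim]
  show "bounded_clinear_on UNIV W" by (rule sl(1))
  \<comment> \<open>Slow variation with shift -\<tau>, evaluated at the times
    \<open>r n + \<tau>\<close>.\<close>
  have "(\<lambda>n. C (r n + \<tau> + - \<tau>) (B (r n + \<tau>) f)) \<longlonglongrightarrow> f"
    using filterlim_compose[OF slow[of "- \<tau>"] rF[of \<tau>]] by simp
  then have "(\<lambda>n. V \<tau> (T (r n) (C (r n) (B (r n + \<tau>) f)))) \<longlonglongrightarrow> V \<tau> (W f)"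
    by (intro bounded_linear.tendsto[OF exp_i_group_bounded_linear[OF V]] sl(2)) simp
  moreover have "V \<tau> (T (r n) (C (r n) (B (r n + \<tau>) f))) = T (r n + \<tau>) (V0 \<tau> f)" for n
  proof -
    have "V0 (- (r n + \<tau>)) (V0 \<tau> g) = V0 (- r n) g" for g
      by (simp flip: exp_i_group_add[OF V0])
    moreover have "V (r n + \<tau>) g = V \<tau> (V (r n) g)" for g
      by (simp flip: exp_i_group_add[OF V] add: add.commute)
    ultimately show ?thesis
      by (simp only: T_def inv[OF r(1)] com[OF r(2)])
  qed
  moreover have "(\<lambda>n. T (r n + \<tau>) (V0 \<tau> f)) \<longlonglongrightarrow> W (V0 \<tau> f)"
    using filterlim_compose[OF W rF[of \<tau>]] by (simp add: T_def)
  ultimately show "V \<tau> (W f) = W (V0 \<tau> f)"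
    using LIMSEQ_unique by simp
qed

text \<open>The bound comes from |T' y|^2 = <T T' y, y> \<le> K |T' y| |y|, and linearity from the
  non-degeneracy of \<open>cinner\<close>.\<close>

lemma is_adjoint_bounded_clinear:
  assumes "bounded_clinear_on UNIV T" "is_adjoint T T'"
  shows "bounded_clinear_on UNIV T'"
proof -
  have adj: "cinner x (T' y) = cinner (T x) y" for x y
    using assms(2) by (simp add: is_adjoint_def)
  obtain K where K: "K \<ge> 0" "\<And>x. norm (T x) \<le> norm x * K"
    using bounded_linear.nonneg_bounded[OF bounded_clinear_on_imp_bounded_linear[OF assms(1)]]
    by blast
  have "norm (T' y) \<le> K * norm y" for y
  proof -
    have "norm (T' y) * norm (T' y) = inner (T (T' y)) y"
      using adj[of "T' y" y] by (metis Re_cinner power2_norm_eq_inner power2_eq_square)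
    also have "\<dots> \<le> norm (T (T' y)) * norm y" by (rule norm_cauchy_schwarz)
    also have "\<dots> \<le> (norm (T' y) * K) * norm y" by (intro mult_right_mono K) simp
    finally show ?thesis
      by (cases "T' y = 0") (use K in \<open>auto simp: mult.assoc\<close>)
  qed
  moreover have "T' (x + y) = T' x + T' y" for x y
    by (rule cinner_right_ext) (simp add: adj cinner_add_right)
  moreover have "T' (c *\<^sub>C x) = c *\<^sub>C T' x" for x c
    by (rule cinner_right_ext) (simp add: adj cinner_scaleC_right)
  ultimately show ?thesis
    by (auto simp: bounded_clinear_on_def clinear_on_def csubspace_UNIV)
qed

lemma proj_onto_UNIV: "proj_onto UNIV f = f"
  unfolding proj_onto_def
proof (rule the_equality)
  show "f \<in> UNIV \<and> (\<forall>h\<in>UNIV. cinner (f - f) h = 0)"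
    by (metis UNIV_I cancel_comm_monoid_add_class.diff_cancel cinner_scaleC_left mult_zero_left of_real_0 scaleR_zero_left scaleC_of_real)
  fix g :: 'a assume "g \<in> UNIV \<and> (\<forall>h\<in>UNIV. cinner (f - g) h = 0)"
  then have "inner (f - g) (f - g) = 0" by (metis Re_cinner UNIV_I zero_complex.sel(1))
  then show "g = f" by simp
qed

text \<open>The groups have the adjoints \<open>V (- t)\<close> and \<open>V0 (- t)\<close>, so
  taking adjoints in the intertwining relation of \<open>Wp\<close> gives
  \<open>Wp' (V t x) = V0 t (Wp' x)\<close>. Combined with the relation for \<open>Wm\<close>, the
  operator \<open>S\<close> commutes with the free group, hence with its generator.\<close>

lemma scattering_operator_commutes:
  fixes A A0 :: "'h::chilbert_space \<rightharpoonup> 'h"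
  assumes G: "ac_subspace A0 = UNIV" and A: "self_adjoint A"
    and A0: "linear_operator A0" "symmetric_operator A0" "closure (dom A0) = UNIV"
    and gw: "generalized_wave_operators A A0 R W0 Wp Wm"
    and S: "scattering_operator Wp Wm S"
    and f: "A0 f = Some g"
  shows "A0 (S f) = Some (S g)"
proof -
  note gw' = gw[unfolded generalized_wave_operators_def deviation_factor_def Let_def G proj_onto_UNIV]
  obtain V V0 where V: "exp_i_group A V" and V0: "exp_i_group A0 V0"
    and Wp: "\<And>f. ((\<lambda>t. V t (V0 (- t) (inv_into UNIV (W0 t) f))) \<longlongrightarrow> Wp f) at_top"
    and Wm: "\<And>f. ((\<lambda>t. V t (V0 (- t) (inv_into UNIV (W0 t) f))) \<longlongrightarrow> Wm f) at_bot"
    using gw' by auto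
  have bij: "bij (W0 t)" and bW: "bounded_clinear_on UNIV (W0 t)"
    and bI: "bounded_clinear_on UNIV (inv (W0 t))" if "R < \<bar>t\<bar>" for t
    using gw' that by auto
  have comA: "A0 (W0 t f) = Some (W0 t g)" if "R < \<bar>t\<bar>" "A0 f = Some g" for t f g
    using gw' that by (metis option.simps(9))
  \<comment> \<open>The deviation factor is assumed to commute with the generator. The relation is
    carried over to the group and then to the inverse of \<open>W0 t\<close>.\<close>
  have com: "inv (W0 t) (V0 \<tau> f) = V0 \<tau> (inv (W0 t) f)" if t: "R < \<bar>t\<bar>" for t \<tau> f
  proof -
    have "W0 t (V0 \<tau> (inv (W0 t) f)) = V0 \<tau> f"
      using commutes_with_exp_i_group[OF V0 A0 bW[OF t] comA[OF t], of \<tau> "inv (W0 t) f"]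
      by (simp add: surj_f_inv_f bij_is_surj bij[OF t])
    then show ?thesis by (metis bij bij_inv_eq_iff t)
  qed
  have invW: "inv (W0 t) (W0 t f) = f" if "R < \<bar>t\<bar>" for t f
    using bij[OF that] by (simp add: bij_is_inj inv_f_f)
  have slow: "((\<lambda>t. W0 (t + \<tau>) (inv (W0 t) f)) \<longlongrightarrow> f) at_top"
      "((\<lambda>t. W0 (t + \<tau>) (inv (W0 t) f)) \<longlongrightarrow> f) at_bot" for \<tau> f
    using gw' by auto
  have p: "filterlim (\<lambda>n. real n + \<tau>) at_top sequentially" for \<tau>
    by (subst add.commute) (rule filterlim_tendsto_add_at_top[OF tendsto_const filterlim_real_sequentially])
  have m: "filterlim (\<lambda>n. - real n + \<tau>) at_bot sequentially" for \<tau>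
    using p[of "- \<tau>"] by (subst filterlim_uminus_at_bot) simp
  have p': "filterlim (\<lambda>n. \<bar>real n\<bar>) at_top sequentially"
      and m': "filterlim (\<lambda>n. \<bar>- real n\<bar>) at_top sequentially"
    by (simp_all add: filterlim_real_sequentially)
  \<comment> \<open>Here \<open>B\<close> is the inverse of \<open>W0\<close> and \<open>C\<close>
    is \<open>W0\<close> itself; the sequences of times are n and -n.\<close>
  note Wp = wave_operator_intertwines[OF V V0 bI invW com slow(1) Wp p p']
  note Wm = wave_operator_intertwines[OF V V0 bI invW com slow(2) Wm m m']
  obtain Wp' where adj: "is_adjoint Wp Wp'" and S: "S = (\<lambda>f. Wp' (Wm f))"
    using S by (auto simp: scattering_operator_def comp_def)
  have Sb: "bounded_clinear_on UNIV S"
    unfolding S by (intro bounded_clinear_on_compose[OF is_adjoint_bounded_clinear[OF Wp(1) adj] Wm(1)])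
  have adj: "cinner x (Wp' y) = cinner (Wp x) y" for x y
    using adj by (simp add: is_adjoint_def)
  have Vadj: "cinner (V t f) g = cinner f (V (- t) g)" for t f g
    using A by (intro exp_i_group_adjoint[OF V]) (auto simp: self_adjoint_imp_symmetric self_adjoint_def)
  have V0adj: "cinner (V0 t f) g = cinner f (V0 (- t) g)" for t f g
    by (intro exp_i_group_adjoint[OF V0] A0)
  have "Wp' (V t x) = V0 t (Wp' x)" for t x
  proof (rule cinner_right_ext)
    fix y
    have "cinner y (Wp' (V t x)) = cinner (V (- t) (Wp y)) x"
      by (simp add: adj Vadj)
    also have "\<dots> = cinner y (V0 t (Wp' x))"
      by (simp add: Wp flip: adj) (simp add: V0adj)
    finally show "cinner y (Wp' (V t x)) = cinner y (V0 t (Wp' x))" .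
  qed
  then have "S (V0 t x) = V0 t (S x)" for t x
    by (simp add: S flip: Wm(2))
  then show ?thesis
    using commutes_with_generator[of A0 V0 S] V0 Sb f
    by (simp add: bounded_clinear_on_imp_bounded_linear bounded_clinear_on_scaleC)
qed

section \<open>The spectral decomposition of the Dirac symbol\<close>

lemma vector_4 [simp]:
  "(vector [w, x, y, z] :: 'a::zero^4) $ 1 = w"
  "(vector [w, x, y, z] :: 'a::zero^4) $ 2 = x"
  "(vector [w, x, y, z] :: 'a::zero^4) $ 3 = y"
  "(vector [w, x, y, z] :: 'a::zero^4) $ 4 = z"
  by (simp_all add: vector_def)

lemma dirac_symbol_mult:
  "(dirac_symbol m q *v v) $ 1 = m * v$1 + (q$3) * v$3 + (q$1 - \<i> * q$2) * v$4"
  "(dirac_symbol m q *v v) $ 2 = m * v$2 + (q$1 + \<i> * q$2) * v$3 - q$3 * v$4"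
  "(dirac_symbol m q *v v) $ 3 = q$3 * v$1 + (q$1 - \<i> * q$2) * v$2 - m * v$3"
  "(dirac_symbol m q *v v) $ 4 = (q$1 + \<i> * q$2) * v$1 - q$3 * v$2 - m * v$4"
  by (simp_all add: dirac_symbol_def Let_def matrix_vector_mult_def sum_4)

lemma cdot_4: "cdot v w = v$1 * cnj (w$1) + v$2 * cnj (w$2) + v$3 * cnj (w$3) + v$4 * cnj (w$4)"
  for v w :: "complex^4"
  by (simp add: cdot_def sum_4)

lemma cdot_add_right: "cdot w (u + v) = cdot w u + cdot w v"
  by (metis cdot_add_left cdot_commute complex_cnj_add)

lemma cdot_scaleC_right: "cdot v (c *s w) = cnj c * cdot v w"
  by (metis cdot_scaleC_left cdot_commute complex_cnj_mult)

lemma dirac_symbol_hermitian: "cdot (dirac_symbol m q *v v) w = cdot v (dirac_symbol m q *v w)"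
  unfolding cdot_4 dirac_symbol_mult by (simp add: algebra_simps)

lemma dirac_energy_sq: "(dirac_energy m q)\<^sup>2 = m\<^sup>2 + ((q$1)\<^sup>2 + (q$2)\<^sup>2 + (q$3)\<^sup>2)"
  by (simp add: dirac_energy_def)

lemma dirac_energy_pos: "m > 0 \<Longrightarrow> dirac_energy m q > 0"
  by (simp add: dirac_energy_def add_pos_nonneg)

text \<open>The Clifford relations: \<open>dirac_symbol m q\<close> is a combination, with
  coefficients m, q_1, q_2, q_3, of four anticommuting matrices with square 1, so all mixed terms
  cancel.\<close>

lemma dirac_symbol_square:
  "dirac_symbol m q *v (dirac_symbol m q *v v) = of_real ((dirac_energy m q)\<^sup>2) *s v"
  unfolding vec_eq_iff forall_4 dirac_symbol_mult vector_smult_component dirac_energy_sq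
  by (simp add: algebra_simps power2_eq_square)

lemma dirac_energy_nonneg: "dirac_energy m q \<ge> 0"
  by (simp add: dirac_energy_def)

text \<open>Since <H v, H v> = <v, H^2 v>. Domain conditions for the free operator thereby become
  integrability with the scalar weight \<lambda>^2.\<close>

lemma norm_dirac_symbol: "norm (dirac_symbol m q *v v) = dirac_energy m q * norm v"
proof -
  have "cdot (dirac_symbol m q *v v) (dirac_symbol m q *v v) =
      complex_of_real ((dirac_energy m q)\<^sup>2) * cdot v v"
    by (simp only: dirac_symbol_hermitian dirac_symbol_square cdot_scaleC_right
        complex_cnj_complex_of_real)
  then have "(norm (dirac_symbol m q *v v))\<^sup>2 = (dirac_energy m q * norm v)\<^sup>2"
    by (simp only: cdot_self power_mult_distrib of_real_mult[symmetric] of_real_eq_iff)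
  then show ?thesis
    by (rule power2_eq_imp_eq) (simp_all add: dirac_energy_nonneg)
qed

text \<open>For s = 1 and s = -1 this is the spectral projector (1 + s H/\<lambda>)/2 of H(q) for
  the eigenvalue s \<lambda>. The entrywise form makes measurability in q immediate.\<close>

definition energy_projector :: "real \<Rightarrow> real \<Rightarrow> real^3 \<Rightarrow> complex^4^4" where
  "energy_projector m s q =
     (\<chi> i j. ((if i = j then 1 else 0) + of_real (s / dirac_energy m q) * dirac_symbol m q $ i $ j) / 2)"

lemma energy_projector_mult:
  "energy_projector m s q *v v =
     (1/2) *s (v + of_real (s / dirac_energy m q) *s (dirac_symbol m q *v v))"
proof -
  have "(\<Sum>j\<in>UNIV. (if i = j then 1 else 0) * v $ j) = v $ i" for i
    by (simp add: if_distrib[of "\<lambda>x. x * _"] cong: if_cong)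
  then show ?thesis
    by (simp add: vec_eq_iff energy_projector_def matrix_vector_mult_def sum_distrib_left
        sum.distrib add_divide_distrib distrib_right mult.assoc flip: sum_divide_distrib)
qed

lemma dirac_symbol_vec_linear:
  "dirac_symbol m q *v (c *s v) = c *s (dirac_symbol m q *v v)"
  by (simp add: vector_scalar_commute)

context
  fixes m s :: real and q :: "real^3"
  assumes m: "m > 0" and s: "s\<^sup>2 = 1"
begin

lemma dirac_symbol_energy_projector:
  "dirac_symbol m q *v (energy_projector m s q *v v) =
     of_real (s * dirac_energy m q) *s (energy_projector m s q *v v)"
proof -
  define l where "l = dirac_energy m q"
  have l: "l \<noteq> 0" and "l = s * (s * l)"
    using dirac_energy_pos[OF m, of q] s by (simp_all add: l_def power2_eq_square flip: mult.assoc)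
  then have *: "complex_of_real l = of_real s * (of_real s * of_real l)"
    by (metis of_real_mult)
  show ?thesis
    unfolding energy_projector_mult matrix_vector_right_distrib dirac_symbol_vec_linear
      dirac_symbol_square l_def[symmetric]
    using l * by (simp add: vec_eq_iff field_simps power2_eq_square)
qed

lemma energy_projector_eigenvector:
  assumes "dirac_symbol m q *v v = of_real (s * dirac_energy m q) *s v"
  shows "energy_projector m s q *v v = v"
  using dirac_energy_pos[OF m, of q] s unfolding energy_projector_mult assms
  by (simp add: vec_eq_iff field_simps power2_eq_square flip: of_real_mult)

lemma energy_projector_idem:
  "energy_projector m s q *v (energy_projector m s q *v v) = energy_projector m s q *v v"
  by (rule energy_projector_eigenvector[OF dirac_symbol_energy_projector])

end

lemma energy_projector_complement:
  "energy_projector m (- s) q *v v = v - energy_projector m s q *v v"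
  unfolding energy_projector_mult by (simp add: vec_eq_iff field_simps)

lemma energy_projector_hermitian:
  "cdot (energy_projector m s q *v v) w = cdot v (energy_projector m s q *v w)"
  unfolding energy_projector_mult
  by (simp add: cdot_scaleC_left cdot_scaleC_right cdot_add_left cdot_add_right dirac_symbol_hermitian)

lemma energy_projector_orthogonal:
  assumes "m > 0" "s\<^sup>2 = 1"
  shows "energy_projector m s q *v (energy_projector m (- s) q *v v) = 0"
  by (simp add: energy_projector_complement matrix_vector_mult_diff_distrib energy_projector_idem[OF assms])

lemma energy_projector_norm:
  assumes "m > 0" "s\<^sup>2 = 1"
  shows "cdot (energy_projector m s q *v v) v = of_real ((norm (energy_projector m s q *v v))\<^sup>2)"
  by (metis cdot_self energy_projector_hermitian energy_projector_idem[OF assms])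

section \<open>The projectors onto the spans of the eigenvectors\<close>

text \<open>Uniqueness for the \<open>THE\<close>: the difference d of two candidates at v lies in
  M, and it is also orthogonal to M as a difference of two residuals, so <d, d> = 0.\<close>

lemma orth_projector_eqI:
  fixes P :: "complex^'n^'n"
  assumes M: "vec.subspace M" and P: "\<And>v. P *v v \<in> M" "\<And>v w. w \<in> M \<Longrightarrow> cdot (v - P *v v) w = 0"
  shows "orth_projector M = P"
  unfolding orth_projector_def
proof (rule the_equality)
  show "\<forall>v. P *v v \<in> M \<and> (\<forall>w\<in>M. cdot (v - P *v v) w = 0)"
    using P by blast
  fix P' assume P': "\<forall>v. P' *v v \<in> M \<and> (\<forall>w\<in>M. cdot (v - P' *v v) w = 0)"
  have "P' *v v = P *v v" for v
  proof -
    define d where "d = P' *v v - P *v v"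
    have d: "d \<in> M" using P P' M by (simp add: d_def vec.subspace_diff)
    have "cdot (v - P *v v) d = cdot (d + (v - P' *v v)) d"
      by (simp add: d_def)
    then have "cdot d d = 0"
      using P(2)[OF d, of v] P' d by (simp only: cdot_add_left) simp
    then show ?thesis by (simp add: cdot_self d_def)
  qed
  then show "P' = P" by (simp add: matrix_eq)
qed

text \<open>The third and fourth entries of an eigenvector are its coordinates with respect to \<open>g\<^sub>k\<close>: the
  first two rows of the eigenvalue equation determine the other entries.\<close>

lemma dirac_eigenspace_eq:
  assumes m: "m > 0" and q: "q \<noteq> 0" and n: "n = 1 \<and> s = -1 \<or> n = 2 \<and> s = 1"
  shows "dirac_eigenspace m n q = {v. dirac_symbol m q *v v = of_real (s * dirac_energy m q) *s v}"
    (is "_ = ?E")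
proof -
  define l where "l = dirac_energy m q"
  \<comment> \<open>With s the sign of the eigenvalue, the denominators m + \<lambda> and m -
    \<lambda> are both m - s \<lambda>, so the two pairs of vectors are treated at once. It is
    nonzero because m = s \<lambda> would force |q| = 0.\<close>
  define d where "d = complex_of_real (m - s * l)"
  define a where "a = (vector [(- q$1 + \<i> * q$2) / d, q$3 / d, 0, 1] :: complex^4)"
  define b where "b = (vector [- q$3 / d, (- q$1 - \<i> * q$2) / d, 1, 0] :: complex^4)"
  have "dirac_eigenspace m n q = vec.span {a, b}"
    using n by (auto simp: dirac_eigenspace_def dirac_eigenvector_def Let_def a_def b_def d_def l_def)
  have s2: "s * s = 1" using n by auto
  have l2: "l * l = m * m + (q$1 * q$1 + q$2 * q$2 + q$3 * q$3)"
    using dirac_energy_sq[of m q] by (simp add: l_def power2_eq_square)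
  have "q$1 \<noteq> 0 \<or> q$2 \<noteq> 0 \<or> q$3 \<noteq> 0"
    using q by (auto simp: vec_eq_iff forall_3)
  then have "q$1 * q$1 + q$2 * q$2 + q$3 * q$3 > 0" (is "?r > 0")
    by (smt (verit) mult_eq_0_iff zero_le_square)
  then have "m \<noteq> s * l"
  proof (intro notI)
    assume "m = s * l"
    then have "m * m = (s * s) * (l * l)" by simp
    then show False using l2 s2 \<open>?r > 0\<close> by simp
  qed
  then have d: "d \<noteq> 0" unfolding d_def of_real_eq_0_iff by simp
  define L where "L = complex_of_real (s * l)"
  have m': "complex_of_real m = d + L" by (simp add: d_def L_def)
  have "(m - s * l) * (m + s * l) = m * m - (s * s) * (l * l)"
    by (simp add: algebra_simps)
  then have "(m - s * l) * (m + s * l) = - (q$1 * q$1 + q$2 * q$2 + q$3 * q$3)"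
    using l2 s2 by simp
  then have "d * complex_of_real (m + s * l) = of_real (- (q$1 * q$1 + q$2 * q$2 + q$3 * q$3))"
    unfolding d_def of_real_mult[symmetric] by (simp only:)
  \<comment> \<open>This is (m - s \<lambda>)(m + s \<lambda>) = - |q|^2, which the last two rows of
    the eigenvalue equation for \<open>a\<close> and \<open>b\<close> come down to.\<close>
  then have dL: "d * (d + 2 * L) = - (of_real (q$1) * of_real (q$1) + of_real (q$2) * of_real (q$2) + of_real (q$3) * of_real (q$3))"
    by (simp add: d_def L_def algebra_simps)
  have E: "v \<in> ?E \<longleftrightarrow> dirac_symbol m q *v v = L *s v" for v
    by (simp add: L_def l_def)
  have "{a, b} \<subseteq> ?E"
    unfolding insert_subset E
    unfolding vec_eq_iff forall_4 dirac_symbol_mult vector_smult_component m'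
    using d by (simp add: a_def b_def field_simps) (use dL in algebra)
  moreover have "vec.subspace ?E"
    by (auto simp: vec.subspace_def matrix_vector_right_distrib dirac_symbol_vec_linear
        vec_eq_iff algebra_simps)
  ultimately have "vec.span {a, b} \<subseteq> ?E"
    by (rule vec.span_minimal)
  moreover have "v \<in> vec.span {a, b}" if "v \<in> ?E" for v
  proof -
    have v: "d * v$1 = - (q$3) * v$3 - (q$1 - \<i> * q$2) * v$4"
         "d * v$2 = - (q$1 + \<i> * q$2) * v$3 + q$3 * v$4"
      using that[unfolded E] unfolding vec_eq_iff forall_4 dirac_symbol_mult vector_smult_component m'
      by (simp_all add: algebra_simps add_eq_0_iff)
    have "v$1 = (- (q$3) * v$3 - (q$1 - \<i> * q$2) * v$4) / d"
         "v$2 = (- (q$1 + \<i> * q$2) * v$3 + q$3 * v$4) / d"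
      unfolding v[symmetric] using d by simp_all
    then have "v = v$3 *s b + v$4 *s a"
      using d unfolding vec_eq_iff forall_4 by (simp add: a_def b_def) (simp add: field_simps)
    also have "\<dots> \<in> vec.span {a, b}"
      by (intro vec.span_add vec.span_scale vec.span_base) auto
    finally show ?thesis .
  qed
  ultimately show ?thesis
    using \<open>dirac_eigenspace m n q = _\<close> by blast
qed

lemma dirac_projector_eq:
  assumes m: "m > 0" and q: "q \<noteq> 0" and n: "n = 1 \<and> s = -1 \<or> n = 2 \<and> s = 1"
  shows "dirac_projector m n q = energy_projector m s q"
proof -
  have s: "s\<^sup>2 = 1" using n by auto
  show ?thesis
    unfolding dirac_projector_def
  proof (rule orth_projector_eqI)
    show "vec.subspace (dirac_eigenspace m n q)"
      by (simp add: dirac_eigenspace_def)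
    show "energy_projector m s q *v v \<in> dirac_eigenspace m n q" for v
      by (simp only: dirac_eigenspace_eq[OF assms] mem_Collect_eq dirac_symbol_energy_projector[OF m s])
    fix v w assume "w \<in> dirac_eigenspace m n q"
    then have "energy_projector m s q *v w = w"
      by (simp only: dirac_eigenspace_eq[OF assms] mem_Collect_eq energy_projector_eigenvector[OF m s])
    then have "cdot (energy_projector m s q *v (v - energy_projector m s q *v v)) w =
        cdot (v - energy_projector m s q *v v) w"
      by (simp add: energy_projector_hermitian)
    then show "cdot (v - energy_projector m s q *v v) w = 0"
      by (simp add: matrix_vector_mult_diff_distrib energy_projector_idem[OF m s])
         (simp add: cdot_def)
  qed
qed

text \<open>Each summand P M P equals P P M = P M, and the two projectors add up to the identity.
  The index n = 1 carries the negative energy.\<close>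

lemma commuting_matrix_decomposition:
  assumes m: "m > 0" and q: "q \<noteq> 0"
    and com: "\<And>v. M *v (dirac_symbol m q *v v) = dirac_symbol m q *v (M *v v)"
  shows "M = (\<Sum>n=1..2. dirac_projector m n q ** M ** dirac_projector m n q)"
proof -
  have com': "M *v (energy_projector m s q *v v) = energy_projector m s q *v (M *v v)" for s v
    by (simp add: energy_projector_mult vector_scalar_commute matrix_vector_right_distrib com)
  have "M *v v = energy_projector m (-1) q *v (M *v (energy_projector m (-1) q *v v)) +
      energy_projector m 1 q *v (M *v (energy_projector m 1 q *v v))" for v
    by (simp only: com' energy_projector_idem[OF m, of "-1", simplified] energy_projector_idem[OF m, of 1, simplified])
       (simp add: energy_projector_complement)
  then have "M = energy_projector m (-1) q ** M ** energy_projector m (-1) q +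
      energy_projector m 1 q ** M ** energy_projector m 1 q"
    unfolding matrix_eq matrix_vector_mult_add_rdistrib matrix_vector_mul_assoc[symmetric] by blast
  moreover have "{1..2} = {1, 2::nat}" by auto
  ultimately show ?thesis
    using dirac_projector_eq[OF m q, of 1 "-1"] dirac_projector_eq[OF m q, of 2 1] by simp
qed

section \<open>The level sets of the energy\<close>

text \<open>\<open>dirac_energy 0 q\<close> is the Euclidean norm |q|. On a ray with q \<noteq> 0
  the energy is thus an explicitly invertible function of t > 0.\<close>

lemma dirac_energy_scaleR: "dirac_energy m (t *\<^sub>R q) = sqrt (m\<^sup>2 + t\<^sup>2 * (dirac_energy 0 q)\<^sup>2)"
  by (simp add: dirac_energy_def power_mult_distrib distrib_left)

lemma continuous_on_dirac_energy: "continuous_on UNIV (dirac_energy m)"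
  unfolding dirac_energy_def by (intro continuous_intros)

lemma borel_measurable_dirac_energy [measurable]: "dirac_energy m \<in> borel_measurable borel"
  by (intro borel_measurable_continuous_onI continuous_on_dirac_energy)

lemma dirac_energy_0_pos: "q \<noteq> 0 \<Longrightarrow> dirac_energy 0 q > 0"
proof -
  assume "q \<noteq> 0"
  then have "q$1 \<noteq> 0 \<or> q$2 \<noteq> 0 \<or> q$3 \<noteq> 0"
    by (auto simp: vec_eq_iff forall_3)
  then have "(q$1)\<^sup>2 + (q$2)\<^sup>2 + (q$3)\<^sup>2 > 0"
    by (smt (verit) zero_less_power2 zero_le_power2)
  then show ?thesis by (simp add: dirac_energy_def)
qed

text \<open>On every ray \<open>t \<mapsto> t q\<close> the energy hits the null set \<open>N\<close> in a null set of parameters \<open>t\<close>. By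
  Fubini, for almost every \<open>t\<close> the points \<open>q\<close> with \<open>\<lambda>(t q) \<in> N\<close> form a null set, and one such \<open>t\<close>
  suffices.\<close>

lemma AE_dirac_energy_notin:
  assumes N: "N \<in> null_sets lborel" and s: "s\<^sup>2 = 1"
  shows "AE q in lebesgue. s * dirac_energy m q \<notin> N"
proof -
  have [measurable]: "N \<in> sets borel" using N by auto
  \<comment> \<open>Restricting to t > 0 makes t the nonnegative root computed from the
    energy.\<close>
  define P where "P t q \<longleftrightarrow> (0 < t \<longrightarrow> s * dirac_energy m (t *\<^sub>R q) \<notin> N)" for t :: real and q :: "real^3"
  have ray: "AE t in lborel. P t q" if q: "q \<noteq> 0" for q
  proof -
    define c where "c = (dirac_energy 0 q)\<^sup>2"
    have c: "c > 0" using dirac_energy_0_pos[OF q] by (simp add: c_def)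
    let ?T = "{t. 0 < t \<and> s * sqrt (m\<^sup>2 + t\<^sup>2 * c) \<in> N}"
    \<comment> \<open>The inverse of the energy along the ray. It is differentiable where x^2 > m^2,
      which covers all t > 0, and differentiable images of null sets are null.\<close>
    let ?g = "\<lambda>x. sqrt ((x\<^sup>2 - m\<^sup>2) / c)"
    have "?T \<subseteq> ?g ` (N \<inter> {x. m\<^sup>2 < x\<^sup>2})"
    proof
      fix t assume t: "t \<in> ?T"
      let ?x = "s * sqrt (m\<^sup>2 + t\<^sup>2 * c)"
      have x: "?x\<^sup>2 = m\<^sup>2 + t\<^sup>2 * c"
        using s c by (simp add: power_mult_distrib)
      then have "t = ?g ?x" using t c by simp
      moreover have "m\<^sup>2 < ?x\<^sup>2" using x t c by simp
      ultimately show "t \<in> ?g ` (N \<inter> {x. m\<^sup>2 < x\<^sup>2})" using t by blast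
    qed
    moreover have "negligible (?g ` (N \<inter> {x. m\<^sup>2 < x\<^sup>2}))"
    proof (rule negligible_differentiable_image_negligible)
      have "negligible N"
        using N by (simp add: negligible_iff_null_sets null_sets_completionI)
      then show "negligible (N \<inter> {x. m\<^sup>2 < x\<^sup>2})" by (rule negligible_subset) blast
      show "?g differentiable_on (N \<inter> {x. m\<^sup>2 < x\<^sup>2})"
        unfolding differentiable_on_def
      proof
        fix x assume "x \<in> N \<inter> {x. m\<^sup>2 < x\<^sup>2}"
        then have "(x\<^sup>2 - m\<^sup>2) / c > 0" using c by simp
        then have "(?g has_real_derivative (2 * x / c) * (inverse (?g x) / 2)) (at x)"
          by (auto intro!: derivative_eq_intros simp: field_simps)
        then show "?g differentiable (at x within N \<inter> {x. m\<^sup>2 < x\<^sup>2})"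
          by (meson differentiable_at_withinI real_differentiable_def)
      qed
    qed simp
    ultimately have "negligible ?T" by (rule negligible_subset[rotated])
    then have "?T \<in> null_sets lborel"
      by (subst null_sets_completion_iff[symmetric]) (auto simp: negligible_iff_null_sets)
    then have "AE t in lborel. t \<notin> ?T" by (rule AE_not_in)
    then show ?thesis
      by eventually_elim (simp add: P_def dirac_energy_scaleR c_def)
  qed
  have "AE q in lborel. q \<noteq> (0 :: real^3)" by (rule AE_lborel_singleton)
  then have "AE q in lborel. AE t in lborel. P t q"
    by eventually_elim (rule ray)
  moreover have "{x \<in> space (lborel \<Otimes>\<^sub>M lborel). P (fst x) (snd x)} \<in> sets (lborel \<Otimes>\<^sub>M lborel)"
    unfolding P_def by measurable
  ultimately have "AE t in lborel. AE q in lborel. P t q"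
    using lborel_pair.AE_commute[of P] by simp
  \<comment> \<open>An interval of positive length is not a null set, so it contains a good
    parameter; (0, 1) also ensures t > 0.\<close>
  then have "\<exists>t\<in>{0<..<1}. AE q in lborel. P t q"
  proof (rule contrapos_pp)
    assume "\<not> (\<exists>t\<in>{0<..<1}. AE q in lborel. P t q)"
    then have imp: "(AE q in lborel. P t q) \<Longrightarrow> t \<notin> {0<..<1}" for t by blast
    show "\<not> (AE t in lborel. AE q in lborel. P t q)"
    proof
      assume "AE t in lborel. AE q in lborel. P t q"
      then have "AE t in lborel. t \<notin> {0<..<1::real}"
        by eventually_elim (rule imp)
      then have "{0<..<1::real} \<in> null_sets lborel"
        by (subst AE_iff_null_sets) auto
      then show False by auto
    qed
  qed
  then obtain t where t: "t > 0" and AE: "AE q in lborel. s * dirac_energy m (t *\<^sub>R q) \<notin> N"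
    by (auto simp: P_def)
  \<comment> \<open>The set to be shown null is the dilate of \<open>?S\<close> by t, and linear
    maps preserve null sets; hence a single t is enough.\<close>
  let ?S = "{q. s * dirac_energy m (t *\<^sub>R q) \<in> N}"
  have "?S \<in> null_sets lborel"
    using AE by (subst AE_iff_null_sets) auto
  then have "negligible ?S"
    by (simp add: negligible_iff_null_sets null_sets_completionI)
  then have "negligible ((\<lambda>q. t *\<^sub>R q) ` ?S)"
    by (intro negligible_differentiable_image_negligible) (auto intro!: derivative_intros)
  moreover have "{q. s * dirac_energy m q \<in> N} \<subseteq> (\<lambda>q. t *\<^sub>R q) ` ?S"
  proof
    fix q assume "q \<in> {q. s * dirac_energy m q \<in> N}"
    then show "q \<in> (\<lambda>q. t *\<^sub>R q) ` ?S"
      using t by (intro image_eqI[where x = "(1/t) *\<^sub>R q"]) auto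
  qed
  ultimately have "negligible {q. s * dirac_energy m q \<in> N}"
    by (rule negligible_subset)
  then have "AE q in lebesgue. q \<notin> {q. s * dirac_energy m q \<in> N}"
    unfolding negligible_iff_null_sets by (rule AE_not_in)
  then show ?thesis by simp
qed

section \<open>The free Dirac operator\<close>

lemma norm_axis: "norm (axis i x :: complex^'n) = norm x"
proof -
  have "(\<Sum>j\<in>UNIV. (norm (axis i x $ j :: complex))\<^sup>2) = (norm x)\<^sup>2"
    by (simp add: axis_def if_distrib[of norm] if_distrib[of "\<lambda>x. x\<^sup>2"] cong: if_cong)
  then show ?thesis by (simp add: norm_vec_def L2_set_def)
qed

lemma borel_measurable_vec:
  fixes f :: "'x \<Rightarrow> complex^'n"
  assumes "\<And>i. (\<lambda>q. f q $ i) \<in> borel_measurable M"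
  shows "f \<in> borel_measurable M"
proof -
  have "bounded_linear (axis i :: complex \<Rightarrow> complex^'n)" for i
  proof (rule bounded_linear_intro[where K = 1])
    show "norm (axis i x :: complex^'n) \<le> norm x * 1" for x
      by (simp add: norm_axis)
  qed (simp_all add: axis_def vec_eq_iff)
  then have "(\<lambda>q. axis i (f q $ i) :: complex^'n) \<in> borel_measurable M" for i
    using assms by (intro borel_measurable_continuous_on[of "axis i"] linear_continuous_on)
  then have "(\<lambda>q. \<Sum>i\<in>UNIV. axis i (f q $ i)) \<in> borel_measurable M"
    by (intro borel_measurable_sum)
  moreover have "(\<Sum>i\<in>UNIV. axis i (f q $ i)) = f q" for q
    by (simp add: vec_eq_iff axis_def if_distrib cong: if_cong)
  ultimately show ?thesis by simp
qed

lemma borel_measurable_vec_nth [measurable (raw)]: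
  fixes f :: "'x \<Rightarrow> complex^'n"
  assumes "f \<in> borel_measurable M"
  shows "(\<lambda>q. f q $ i) \<in> borel_measurable M"
  by (rule borel_measurable_continuous_on[OF _ assms]) (auto intro!: continuous_intros)

lemma borel_measurable_matrix_mult:
  fixes K :: "'x \<Rightarrow> complex^'n^'k"
  assumes K: "\<And>i j. (\<lambda>q. K q $ i $ j) \<in> borel_measurable M" and f: "f \<in> borel_measurable M"
  shows "(\<lambda>q. K q *v f q) \<in> borel_measurable M"
proof (rule borel_measurable_vec)
  show "(\<lambda>q. (K q *v f q) $ i) \<in> borel_measurable M" for i
    unfolding matrix_vector_mult_def using K f
    by (simp add: borel_measurable_sum borel_measurable_times borel_measurable_vec_nth)
qed

lemma borel_measurable_lebesgueI: "f \<in> borel_measurable borel \<Longrightarrow> f \<in> borel_measurable lebesgue"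
  by (rule measurable_completion) simp

lemma borel_measurable_dirac_symbol: "(\<lambda>q. dirac_symbol m q $ i $ j) \<in> borel_measurable borel"
proof -
  have "continuous_on UNIV (\<lambda>q. dirac_symbol m q $ i $ j)"
    using exhaust_4[of i] exhaust_4[of j]
    by (elim disjE) (simp_all add: dirac_symbol_def Let_def continuous_intros)
  then show ?thesis by (rule borel_measurable_continuous_onI)
qed

lemma dirac_symbol_mult_measurable [measurable]:
  "(\<lambda>q. dirac_symbol m q *v spinor_fun \<Phi> q) \<in> borel_measurable lebesgue"
  by (rule borel_measurable_matrix_mult[OF borel_measurable_lebesgueI[OF borel_measurable_dirac_symbol]])
     measurable

lemma square_integrable_cong_AE:
  assumes "square_integrable g" "f \<in> borel_measurable lebesgue" "AE q in lebesgue. f q = g q"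
  shows "square_integrable f"
proof -
  have "integrable lebesgue (\<lambda>q. (norm (f q))\<^sup>2) \<longleftrightarrow> integrable lebesgue (\<lambda>q. (norm (g q))\<^sup>2)"
    by (rule integrable_cong_AE) (use assms in \<open>auto simp: square_integrable_def\<close>)
  then show ?thesis using assms by (simp add: square_integrable_def)
qed

text \<open>The graph of the free operator, pointwise almost everywhere. The domain condition is
  contained in it, because the representative of \<open>\<Psi>\<close> is square integrable.\<close>

lemma free_dirac_eq_Some:
  "free_dirac m \<Phi> = Some \<Psi> \<longleftrightarrow>
     (AE q in lebesgue. spinor_fun \<Psi> q = dirac_symbol m q *v spinor_fun \<Phi> q)"
    (is "_ \<longleftrightarrow> ?R")
proof
  assume "free_dirac m \<Phi> = Some \<Psi>"
  then show ?R by (auto simp: free_dirac_def Let_def spinor_fun_mk split: if_splits)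
next
  assume R: ?R
  have sq: "square_integrable (\<lambda>q. dirac_symbol m q *v spinor_fun \<Phi> q)"
    by (rule square_integrable_cong_AE[OF square_integrable_spinor_fun[of \<Psi>]])
       (measurable, use R in \<open>eventually_elim, simp\<close>)
  have "mk_spinor (\<lambda>q. dirac_symbol m q *v spinor_fun \<Phi> q) = \<Psi>"
    by (rule spinor_eqI) (use R spinor_fun_mk[OF sq] in \<open>eventually_elim, simp\<close>)
  then show "free_dirac m \<Phi> = Some \<Psi>" using sq by (simp add: free_dirac_def)
qed

lemma dom_free_dirac:
  "dom (free_dirac m) = {\<Phi>. square_integrable (\<lambda>q. dirac_symbol m q *v spinor_fun \<Phi> q)}"
  by (auto simp: dom_def free_dirac_def Let_def)

lemma free_dirac_add:
  assumes "free_dirac m \<Phi> = Some \<Phi>'" "free_dirac m \<Psi> = Some \<Psi>'"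
  shows "free_dirac m (\<Phi> + \<Psi>) = Some (\<Phi>' + \<Psi>')"
  using assms AE_spinor_fun(2)[of \<Phi> \<Psi>] AE_spinor_fun(2)[of \<Phi>' \<Psi>'] unfolding free_dirac_eq_Some
  by eventually_elim (simp add: matrix_vector_right_distrib)

lemma free_dirac_scaleC:
  assumes "free_dirac m \<Phi> = Some \<Phi>'"
  shows "free_dirac m (c *\<^sub>C \<Phi>) = Some (c *\<^sub>C \<Phi>')"
  using assms AE_spinor_fun(6)[of c \<Phi>] AE_spinor_fun(6)[of c \<Phi>'] unfolding free_dirac_eq_Some
  by eventually_elim (simp add: vector_scalar_commute)

lemma linear_operator_free_dirac: "linear_operator (free_dirac m)"
proof -
  have "free_dirac m 0 = Some 0"
    using AE_spinor_fun(1) unfolding free_dirac_eq_Some by eventually_elim simp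
  then have 0: "0 \<in> dom (free_dirac m)" by blast
  have add: "x + y \<in> dom (free_dirac m) \<and>
      the (free_dirac m (x + y)) = the (free_dirac m x) + the (free_dirac m y)"
    if "x \<in> dom (free_dirac m)" "y \<in> dom (free_dirac m)" for x y
    using that by (auto simp: dom_def free_dirac_add)
  have scale: "c *\<^sub>C x \<in> dom (free_dirac m) \<and>
      the (free_dirac m (c *\<^sub>C x)) = c *\<^sub>C the (free_dirac m x)"
    if "x \<in> dom (free_dirac m)" for c x
    using that by (auto simp: dom_def free_dirac_scaleC)
  show ?thesis
    unfolding linear_operator_def clinear_on_def csubspace_def using 0 add scale by simp
qed

lemma cinner_eq_integral:
  assumes "AE q in lebesgue. spinor_fun \<Phi> q = f q" "AE q in lebesgue. spinor_fun \<Psi> q = g q"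
    and [measurable]: "f \<in> borel_measurable lebesgue" "g \<in> borel_measurable lebesgue"
  shows "cinner \<Phi> \<Psi> = (\<integral>q. cdot (f q) (g q) \<partial>lebesgue)"
  unfolding cinner_spinor_field_def
  by (rule integral_cong_AE) (measurable, use assms(1,2) in \<open>eventually_elim, simp\<close>)

lemma symmetric_operator_free_dirac: "symmetric_operator (free_dirac m)"
  unfolding symmetric_operator_def cinner_spinor_field_def
proof (intro allI impI integral_cong_AE)
  fix \<Phi> \<Psi> \<Phi>' \<Psi>' assume "free_dirac m \<Phi> = Some \<Phi>'" "free_dirac m \<Psi> = Some \<Psi>'"
  then show "AE q in lebesgue. cdot (spinor_fun \<Phi>' q) (spinor_fun \<Psi> q) = cdot (spinor_fun \<Phi> q) (spinor_fun \<Psi>' q)"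
    unfolding free_dirac_eq_Some by eventually_elim (simp add: dirac_symbol_hermitian)
qed measurable

section \<open>From commuting operators to commuting matrices\<close>

text \<open>Constant fields are not square integrable, so the basis vectors are cut off to balls of
  integer radius, on which H is bounded and the test fields lie in the domain. There are countably
  many test fields, hence one null set serves for all; the balls exhaust the momentum space.\<close>

lemma AE_commutes_if_matrix_function:
  assumes T: "matrix_function_of UNIV T M"
    and com: "\<And>\<Phi> \<Psi>. free_dirac m \<Phi> = Some \<Psi> \<Longrightarrow> free_dirac m (T \<Phi>) = Some (T \<Psi>)"
  shows "AE q in lebesgue. \<forall>v. M q *v (dirac_symbol m q *v v) = dirac_symbol m q *v (M q *v v)"
proof -
  define f where "f n j q = indicator (cball 0 (real n)) q *\<^sub>R (axis j 1 :: complex^4)"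
    for n j and q :: "real^3"
  have AE: "AE q in lebesgue. norm q \<le> real n \<longrightarrow>
      M q *v (dirac_symbol m q *v axis j 1) = dirac_symbol m q *v (M q *v axis j 1)" for n j
  proof -
    have fm [measurable]: "f n j \<in> borel_measurable lebesgue"
      unfolding f_def
      by (intro borel_measurable_lebesgueI borel_measurable_scaleR borel_measurable_indicator
          borel_measurable_const) auto
    have sq: "square_integrable (f n j)"
    proof -
      have "integrable lebesgue (indicator (cball 0 (real n)) :: real^3 \<Rightarrow> real)"
        by (rule integrable_real_indicator)
           (use lmeasurable_cball[of 0 "real n"] in \<open>auto simp: fmeasurable_def\<close>)
      moreover have "(norm (f n j q))\<^sup>2 = indicator (cball 0 (real n)) q" for q
        by (simp add: f_def indicator_def norm_axis)
      ultimately show ?thesis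
        using fm by (simp add: square_integrable_def)
    qed
    have sqH: "square_integrable (\<lambda>q. dirac_symbol m q *v f n j q)"
    proof -
      have hm: "(\<lambda>q. dirac_symbol m q *v f n j q) \<in> borel_measurable lebesgue"
        by (rule borel_measurable_matrix_mult[OF borel_measurable_lebesgueI[OF borel_measurable_dirac_symbol] fm])
      have "integrable lebesgue (\<lambda>q. (norm (dirac_symbol m q *v f n j q))\<^sup>2)"
      proof (rule Bochner_Integration.integrable_bound)
        show "integrable lebesgue (\<lambda>q. (m\<^sup>2 + (real n)\<^sup>2) * (norm (f n j q))\<^sup>2)"
          using sq by (simp add: square_integrable_def)
        show "(\<lambda>q. (norm (dirac_symbol m q *v f n j q))\<^sup>2) \<in> borel_measurable lebesgue"
          using hm by measurable
        have "(dirac_energy m q)\<^sup>2 \<le> m\<^sup>2 + (real n)\<^sup>2" if "norm q \<le> n" for q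
        proof -
          have "(norm q)\<^sup>2 \<le> (real n)\<^sup>2" using that by (intro power_mono) auto
          moreover have "(norm q)\<^sup>2 = (q$1)\<^sup>2 + (q$2)\<^sup>2 + (q$3)\<^sup>2"
            unfolding power2_norm_eq_inner by (simp add: inner_vec_def sum_3 power2_eq_square)
          ultimately show ?thesis
            by (simp add: dirac_energy_sq)
        qed
        then show "AE q in lebesgue. norm ((norm (dirac_symbol m q *v f n j q))\<^sup>2)
            \<le> norm ((m\<^sup>2 + (real n)\<^sup>2) * (norm (f n j q))\<^sup>2)"
          by (auto simp: norm_dirac_symbol power_mult_distrib f_def indicator_def norm_axis)
      qed
      then show ?thesis using hm by (simp add: square_integrable_def)
    qed
    let ?\<Phi> = "mk_spinor (f n j)" and ?\<Psi> = "mk_spinor (\<lambda>q. dirac_symbol m q *v f n j q)"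
    have "free_dirac m ?\<Phi> = Some ?\<Psi>"
      unfolding free_dirac_eq_Some using spinor_fun_mk[OF sq] spinor_fun_mk[OF sqH]
      by eventually_elim simp
    from com[OF this] have
      "AE q in lebesgue. spinor_fun (T ?\<Psi>) q = dirac_symbol m q *v spinor_fun (T ?\<Phi>) q"
      unfolding free_dirac_eq_Some .
    moreover have "AE q in lebesgue. spinor_fun (T X) q = M q *v spinor_fun X q" for X
      using T by (simp add: matrix_function_of_def)
    note this[of ?\<Phi>] this[of ?\<Psi>]
    ultimately show ?thesis
      using spinor_fun_mk[OF sq] spinor_fun_mk[OF sqH]
    proof eventually_elim
      case (elim q)
      have "f n j q = axis j 1" if "norm q \<le> real n"
        using that by (simp add: f_def)
      then show ?case using elim by auto
    qed
  qed
  have "AE q in lebesgue. \<forall>n. \<forall>j\<in>UNIV. norm q \<le> real n \<longrightarrow>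
      M q *v (dirac_symbol m q *v axis j 1) = dirac_symbol m q *v (M q *v axis j 1)"
    unfolding AE_all_countable by (intro allI AE_finite_allI AE finite)
  then show ?thesis
  proof eventually_elim
    fix q :: "real^3"
    assume *: "\<forall>n. \<forall>j\<in>UNIV. norm q \<le> real n \<longrightarrow>
      M q *v (dirac_symbol m q *v axis j 1) = dirac_symbol m q *v (M q *v axis j 1)"
    obtain n where "norm q \<le> real n" using real_arch_simple by blast
    then have "(M q ** dirac_symbol m q) *v axis j 1 = (dirac_symbol m q ** M q) *v axis j 1" for j
      unfolding matrix_vector_mul_assoc[symmetric] using * by blast
    moreover have "(K *v axis j 1) $ i = K $ i $ j" for K :: "complex^4^4" and i j
      by (simp add: matrix_vector_mult_def axis_def if_distrib cong: if_cong)
    ultimately have "M q ** dirac_symbol m q = dirac_symbol m q ** M q"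
      unfolding vec_eq_iff by metis
    then show "\<forall>v. M q *v (dirac_symbol m q *v v) = dirac_symbol m q *v (M q *v v)"
      by (simp add: matrix_vector_mul_assoc)
  qed
qed

lemma matrix_function_decomposition:
  assumes m: "m > 0" and T: "matrix_function_of UNIV T M"
    and com: "\<And>\<Phi> \<Psi>. free_dirac m \<Phi> = Some \<Psi> \<Longrightarrow> free_dirac m (T \<Phi>) = Some (T \<Psi>)"
  shows "AE q in lebesgue. M q = (\<Sum>n=1..2. dirac_projector m n q ** M q ** dirac_projector m n q)"
proof -
  \<comment> \<open>The point q = 0 is removed because the denominators of g_3 and g_4 vanish
    there.\<close>
  have "{0 :: real^3} \<in> null_sets lebesgue"
    by (simp add: negligible_iff_null_sets[symmetric])
  then have "AE q in lebesgue. q \<notin> {0 :: real^3}"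
    by (rule AE_not_in)
  moreover have "AE q in lebesgue. \<forall>v. M q *v (dirac_symbol m q *v v) = dirac_symbol m q *v (M q *v v)"
    by (rule AE_commutes_if_matrix_function[OF T]) (rule com)
  ultimately show ?thesis
    by eventually_elim (rule commuting_matrix_decomposition[OF m], auto)
qed

section \<open>The spectral measure of the free Dirac operator\<close>

text \<open>The indicator function of \<open>B\<close> applied to the hermitian matrix H(q), that
  is, its spectral projector for the set \<open>B\<close>.\<close>

definition spectral_matrix :: "real \<Rightarrow> real set \<Rightarrow> real^3 \<Rightarrow> complex^4^4" where
  "spectral_matrix m B q =
     (if - dirac_energy m q \<in> B then energy_projector m (-1) q else 0) +
     (if dirac_energy m q \<in> B then energy_projector m 1 q else 0)"

definition spectral_op :: "real \<Rightarrow> real set \<Rightarrow> spinor_field \<Rightarrow> spinor_field" where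
  "spectral_op m B \<Phi> = mk_spinor (\<lambda>q. spectral_matrix m B q *v spinor_fun \<Phi> q)"

lemma spectral_matrix_mult:
  "spectral_matrix m B q *v v =
     (if - dirac_energy m q \<in> B then energy_projector m (-1) q *v v else 0) +
     (if dirac_energy m q \<in> B then energy_projector m 1 q *v v else 0)"
  by (simp add: spectral_matrix_def matrix_vector_mult_add_rdistrib)

lemma spectral_matrix_hermitian:
  "cdot (spectral_matrix m B q *v v) w = cdot v (spectral_matrix m B q *v w)"
proof -
  have 0: "cdot (0 :: complex^4) x = 0" "cdot x (0 :: complex^4) = 0" for x
    by (simp_all add: cdot_def)
  show ?thesis
    by (simp add: spectral_matrix_mult cdot_add_left cdot_add_right energy_projector_hermitian 0)
qed

lemma spectral_matrix_idem:
  assumes "m > 0"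
  shows "spectral_matrix m B q *v (spectral_matrix m B q *v v) = spectral_matrix m B q *v v"
  using energy_projector_idem[OF assms, of 1 q v] energy_projector_idem[OF assms, of "-1" q v]
    energy_projector_orthogonal[OF assms, of 1 q v] energy_projector_orthogonal[OF assms, of "-1" q v]
  by (simp add: spectral_matrix_mult matrix_vector_right_distrib)

lemma spectral_matrix_UNIV: "spectral_matrix m UNIV q *v v = v"
  using energy_projector_complement[of m 1 q v] by (simp add: spectral_matrix_mult)

text \<open>The two terms are the q-densities of the negative and the positive energy part of the
  vector measure.\<close>

lemma cdot_spectral_matrix:
  assumes "m > 0"
  shows "cdot (spectral_matrix m B q *v v) v = of_real
    (indicator B (- dirac_energy m q) * (norm (energy_projector m (-1) q *v v))\<^sup>2 +
     indicator B (dirac_energy m q) * (norm (energy_projector m 1 q *v v))\<^sup>2)"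
proof -
  have 0: "cdot (0 :: complex^4) x = 0" for x
    by (simp add: cdot_def)
  show ?thesis
    using energy_projector_norm[OF assms, of 1 q v] energy_projector_norm[OF assms, of "-1" q v]
    by (simp add: spectral_matrix_mult cdot_add_left 0)
qed

lemma norm_spectral_matrix_sq:
  assumes "m > 0"
  shows "(norm (spectral_matrix m B q *v v))\<^sup>2 =
     indicator B (- dirac_energy m q) * (norm (energy_projector m (-1) q *v v))\<^sup>2 +
     indicator B (dirac_energy m q) * (norm (energy_projector m 1 q *v v))\<^sup>2"
proof -
  have "complex_of_real ((norm (spectral_matrix m B q *v v))\<^sup>2) = cdot (spectral_matrix m B q *v v) v"
    by (metis cdot_self spectral_matrix_hermitian spectral_matrix_idem[OF assms])
  then show ?thesis
    unfolding cdot_spectral_matrix[OF assms] of_real_eq_iff .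
qed

lemma norm_energy_projectors_sq:
  assumes "m > 0"
  shows "(norm (energy_projector m (-1) q *v v))\<^sup>2 + (norm (energy_projector m 1 q *v v))\<^sup>2 = (norm v)\<^sup>2"
  using norm_spectral_matrix_sq[OF assms, of UNIV q v] by (simp add: spectral_matrix_UNIV)

lemma norm_spectral_matrix_le:
  assumes "m > 0"
  shows "(norm (spectral_matrix m B q *v v))\<^sup>2 \<le> (norm v)\<^sup>2"
  unfolding norm_spectral_matrix_sq[OF assms] norm_energy_projectors_sq[OF assms, where q = q and v = v, symmetric]
  by (simp add: indicator_def)

lemma spectral_matrix_disjoint_union:
  "B \<inter> C = {} \<Longrightarrow> spectral_matrix m (B \<union> C) q *v v = spectral_matrix m B q *v v + spectral_matrix m C q *v v"
  by (auto simp: spectral_matrix_mult)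

lemma cdot_dirac_symbol:
  assumes "m > 0"
  shows "cdot (dirac_symbol m q *v v) v = of_real (dirac_energy m q *
    ((norm (energy_projector m 1 q *v v))\<^sup>2 - (norm (energy_projector m (-1) q *v v))\<^sup>2))"
proof -
  have 1: "dirac_symbol m q *v (energy_projector m 1 q *v v) =
      of_real (dirac_energy m q) *s (energy_projector m 1 q *v v)"
    and 2: "dirac_symbol m q *v (energy_projector m (-1) q *v v) =
      of_real (- dirac_energy m q) *s (energy_projector m (-1) q *v v)"
    using dirac_symbol_energy_projector[OF assms, of 1 q v]
      dirac_symbol_energy_projector[OF assms, of "-1" q v] by simp_all
  have "v = energy_projector m 1 q *v v + energy_projector m (-1) q *v v"
    using energy_projector_complement[of m 1 q v] by simp
  then have "dirac_symbol m q *v v = of_real (dirac_energy m q) *s (energy_projector m 1 q *v v) +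
      of_real (- dirac_energy m q) *s (energy_projector m (-1) q *v v)"
    by (metis 1 2 matrix_vector_right_distrib)
  then have "cdot (dirac_symbol m q *v v) v =
      of_real (dirac_energy m q) * of_real ((norm (energy_projector m 1 q *v v))\<^sup>2) +
      of_real (- dirac_energy m q) * of_real ((norm (energy_projector m (-1) q *v v))\<^sup>2)"
    using energy_projector_norm[OF assms, of 1 q v] energy_projector_norm[OF assms, of "-1" q v]
    by (simp only: cdot_add_left cdot_scaleC_left) simp
  then show ?thesis by (simp add: algebra_simps)
qed

lemma borel_measurable_energy_projector:
  "(\<lambda>q. energy_projector m s q $ i $ j) \<in> borel_measurable lebesgue"
proof (rule borel_measurable_lebesgueI)
  note [measurable] = borel_measurable_dirac_symbol[of m i j]
  show "(\<lambda>q. energy_projector m s q $ i $ j) \<in> borel_measurable borel"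
    unfolding energy_projector_def vec_lambda_beta by measurable
qed

lemma dirac_energy_measurable_lebesgue [measurable]: "dirac_energy m \<in> borel_measurable lebesgue"
  by (rule borel_measurable_lebesgueI) measurable

lemma energy_projector_measurable [measurable]:
  "(\<lambda>q. energy_projector m s q *v spinor_fun \<Phi> q) \<in> borel_measurable lebesgue"
  by (rule borel_measurable_matrix_mult[OF borel_measurable_energy_projector]) measurable

lemma spectral_matrix_measurable [measurable (raw)]:
  assumes [measurable]: "B \<in> sets borel"
  shows "(\<lambda>q. spectral_matrix m B q *v spinor_fun \<Phi> q) \<in> borel_measurable lebesgue"
  unfolding spectral_matrix_mult by measurable

lemma square_integrable_spectral_matrix:
  assumes m: "m > 0" and B: "B \<in> sets borel"
  shows "square_integrable (\<lambda>q. spectral_matrix m B q *v spinor_fun \<Phi> q)"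
proof -
  note [measurable] = B
  have "integrable lebesgue (\<lambda>q. (norm (spectral_matrix m B q *v spinor_fun \<Phi> q))\<^sup>2)"
    by (rule Bochner_Integration.integrable_bound[where f = "\<lambda>q. (norm (spinor_fun \<Phi> q))\<^sup>2"])
       (use square_integrable_spinor_fun[of \<Phi>] norm_spectral_matrix_le[OF m] in
         \<open>auto simp: square_integrable_def\<close>)
  then show ?thesis by (simp add: square_integrable_def)
qed

context
  fixes m :: real
  assumes m: "m > 0"
begin

lemma AE_spectral_op:
  "B \<in> sets borel \<Longrightarrow>
    AE q in lebesgue. spinor_fun (spectral_op m B \<Phi>) q = spectral_matrix m B q *v spinor_fun \<Phi> q"
  unfolding spectral_op_def by (intro spinor_fun_mk square_integrable_spectral_matrix m)

lemma clinear_on_spectral_op: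
  assumes B: "B \<in> sets borel"
  shows "clinear_on UNIV (spectral_op m B)"
proof -
  note AE = AE_spectral_op[OF B]
  have "spectral_op m B (\<Phi> + \<Psi>) = spectral_op m B \<Phi> + spectral_op m B \<Psi>" for \<Phi> \<Psi>
    by (rule spinor_eqI)
       (use AE[of \<Phi>] AE[of \<Psi>] AE[of "\<Phi> + \<Psi>"] AE_spinor_fun(2)[of \<Phi> \<Psi>]
          AE_spinor_fun(2)[of "spectral_op m B \<Phi>" "spectral_op m B \<Psi>"] in
         \<open>eventually_elim, simp add: matrix_vector_right_distrib\<close>)
  moreover have "spectral_op m B (c *\<^sub>C \<Phi>) = c *\<^sub>C spectral_op m B \<Phi>" for c \<Phi>
    by (rule spinor_eqI)
       (use AE[of \<Phi>] AE[of "c *\<^sub>C \<Phi>"] AE_spinor_fun(6)[of c \<Phi>]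
          AE_spinor_fun(6)[of c "spectral_op m B \<Phi>"] in
         \<open>eventually_elim, simp add: vector_scalar_commute\<close>)
  ultimately show ?thesis by (simp add: clinear_on_def csubspace_def)
qed

lemma spectral_op_idem:
  assumes B: "B \<in> sets borel"
  shows "spectral_op m B (spectral_op m B \<Phi>) = spectral_op m B \<Phi>"
  by (rule spinor_eqI)
     (use AE_spectral_op[OF B, of \<Phi>] AE_spectral_op[OF B, of "spectral_op m B \<Phi>"] in
       \<open>eventually_elim, simp add: spectral_matrix_idem[OF m]\<close>)

lemma spectral_op_adjoint:
  assumes B: "B \<in> sets borel"
  shows "is_adjoint (spectral_op m B) (spectral_op m B)"
  unfolding is_adjoint_def
proof (intro allI)
  fix \<Phi> \<Psi>
  show "cinner (spectral_op m B \<Phi>) \<Psi> = cinner \<Phi> (spectral_op m B \<Psi>)"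
    unfolding cinner_spinor_field_def
  proof (rule integral_cong_AE)
    show "AE q in lebesgue. cdot (spinor_fun (spectral_op m B \<Phi>) q) (spinor_fun \<Psi> q) =
        cdot (spinor_fun \<Phi> q) (spinor_fun (spectral_op m B \<Psi>) q)"
      using AE_spectral_op[OF B, of \<Phi>] AE_spectral_op[OF B, of \<Psi>]
      by eventually_elim (simp add: spectral_matrix_hermitian)
  qed measurable
qed

lemma spectral_op_UNIV: "spectral_op m UNIV \<Phi> = \<Phi>"
proof -
  have "AE q in lebesgue. spinor_fun (spectral_op m UNIV \<Phi>) q = spectral_matrix m UNIV q *v spinor_fun \<Phi> q"
    by (rule AE_spectral_op) simp
  then show ?thesis by (intro spinor_eqI) (simp add: spectral_matrix_UNIV)
qed

lemma spectral_op_disjoint_union: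
  assumes B: "B \<in> sets borel" and C: "C \<in> sets borel" and BC: "B \<inter> C = {}"
  shows "spectral_op m (B \<union> C) \<Phi> = spectral_op m B \<Phi> + spectral_op m C \<Phi>"
  by (rule spinor_eqI)
     (use AE_spectral_op[OF B, of \<Phi>] AE_spectral_op[OF C, of \<Phi>] AE_spectral_op[OF sets.Un[OF B C], of \<Phi>]
        AE_spinor_fun(2)[of "spectral_op m B \<Phi>" "spectral_op m C \<Phi>"] in
       \<open>eventually_elim, simp add: spectral_matrix_disjoint_union[OF BC]\<close>)

text \<open>At each q only the two points \<lambda> and -\<lambda> matter, and both eventually leave
  \<open>C n\<close>; dominated convergence with |\<Phi>|^2 does the rest. Used for tails of
  disjoint unions and for high energies.\<close>

lemma spectral_op_tendsto_0:
  assumes C: "\<And>n. C n \<in> sets borel" and ev: "\<And>x. \<forall>\<^sub>F n in sequentially. x \<notin> C n"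
  shows "(\<lambda>n. spectral_op m (C n) \<Phi>) \<longlonglongrightarrow> 0"
proof -
  note [measurable] = C
  have "(\<lambda>n. \<integral>q. (norm (spectral_matrix m (C n) q *v spinor_fun \<Phi> q))\<^sup>2 \<partial>lebesgue)
      \<longlonglongrightarrow> (\<integral>q. 0 \<partial>(lebesgue :: (real^3) measure))"
  proof (rule integral_dominated_convergence)
    show "integrable lebesgue (\<lambda>q. (norm (spinor_fun \<Phi> q))\<^sup>2)"
      using square_integrable_spinor_fun[of \<Phi>] by (simp add: square_integrable_def)
    show "AE q in lebesgue. (\<lambda>n. (norm (spectral_matrix m (C n) q *v spinor_fun \<Phi> q))\<^sup>2) \<longlonglongrightarrow> 0"
    proof (rule AE_I2)
      fix q :: "real^3"
      show "(\<lambda>n. (norm (spectral_matrix m (C n) q *v spinor_fun \<Phi> q))\<^sup>2) \<longlonglongrightarrow> 0"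
      proof (rule tendsto_eventually)
        show "\<forall>\<^sub>F n in sequentially. (norm (spectral_matrix m (C n) q *v spinor_fun \<Phi> q))\<^sup>2 = 0"
          using ev[of "dirac_energy m q"] ev[of "- dirac_energy m q"]
          by eventually_elim (simp add: norm_spectral_matrix_sq[OF m])
      qed
    qed
    show "AE q in lebesgue. norm ((norm (spectral_matrix m (C n) q *v spinor_fun \<Phi> q))\<^sup>2)
        \<le> (norm (spinor_fun \<Phi> q))\<^sup>2" for n
      using norm_spectral_matrix_le[OF m] by simp
  qed measurable
  moreover have "(\<integral>q. (norm (spectral_matrix m (C n) q *v spinor_fun \<Phi> q))\<^sup>2 \<partial>lebesgue) =
      (norm (spectral_op m (C n) \<Phi>))\<^sup>2" for n
    unfolding power2_norm_eq_inner inner_spinor_field_def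
    by (rule integral_cong_AE)
       (measurable, use AE_spectral_op[OF C, of n \<Phi>] in \<open>eventually_elim, simp\<close>)
  ultimately have "(\<lambda>n. (norm (spectral_op m (C n) \<Phi>))\<^sup>2) \<longlonglongrightarrow> 0" by simp
  then have "(\<lambda>n. sqrt ((norm (spectral_op m (C n) \<Phi>))\<^sup>2)) \<longlonglongrightarrow> sqrt 0"
    by (rule tendsto_real_sqrt)
  then show ?thesis by (simp add: tendsto_norm_zero_iff)
qed

lemma spectral_op_sums:
  assumes B: "range B \<subseteq> sets borel" and disj: "disjoint_family B"
  shows "(\<lambda>n. spectral_op m (B n) \<Phi>) sums spectral_op m (\<Union>n. B n) \<Phi>"
proof -
  \<comment> \<open>Tail unions: E(B n) = E(C n) - E(C (n + 1)), so partial sums telescope.\<close>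
  define C where "C n = (\<Union>k. B (k + n))" for n
  have Bm: "B n \<in> sets borel" for n using B by auto
  have Cm: "C n \<in> sets borel" for n unfolding C_def by (intro sets.countable_UN) (use Bm in auto)
  have "spectral_op m (B n) \<Phi> = spectral_op m (C n) \<Phi> - spectral_op m (C (Suc n)) \<Phi>" for n
  proof -
    have "C n = B n \<union> C (Suc n)"
    proof (intro set_eqI iffI)
      fix x assume "x \<in> C n"
      then obtain k where "x \<in> B (k + n)" by (auto simp: C_def)
      then show "x \<in> B n \<union> C (Suc n)"
        by (cases k) (auto simp: C_def)
    next
      fix x assume "x \<in> B n \<union> C (Suc n)"
      then obtain k where "x \<in> B (0 + n) \<or> x \<in> B (Suc k + n)" by (auto simp: C_def)
      then show "x \<in> C n" unfolding C_def by blast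
    qed
    moreover have "B n \<inter> B (k + Suc n) = {}" for k
      using disj by (simp add: disjoint_family_on_def)
    then have "B n \<inter> C (Suc n) = {}"
      unfolding C_def by blast
    ultimately show ?thesis
      using spectral_op_disjoint_union[OF Bm[of n] Cm[of "Suc n"]] by simp
  qed
  then have "(\<Sum>k<n. spectral_op m (B k) \<Phi>) = spectral_op m (C 0) \<Phi> - spectral_op m (C n) \<Phi>" for n
    by (induction n) simp_all
  moreover have "(\<lambda>n. spectral_op m (C n) \<Phi>) \<longlonglongrightarrow> 0"
  proof (rule spectral_op_tendsto_0[OF Cm])
    fix x
    show "\<forall>\<^sub>F n in sequentially. x \<notin> C n"
    proof (cases "\<exists>k. x \<in> B k")
      case True
      then obtain k where k: "x \<in> B k" by blast
      have "x \<notin> C n" if "n > k" for n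
      proof
        assume "x \<in> C n"
        then obtain j where "x \<in> B (j + n)" by (auto simp: C_def)
        moreover have "B k \<inter> B (j + n) = {}"
          using disj that by (simp add: disjoint_family_on_def)
        ultimately show False using k by blast
      qed
      then show ?thesis by (intro eventually_sequentiallyI[of "Suc k"]) simp
    qed (simp add: C_def)
  qed
  then have "(\<lambda>n. spectral_op m (C 0) \<Phi> - spectral_op m (C n) \<Phi>) \<longlonglongrightarrow> spectral_op m (C 0) \<Phi> - 0"
    by (intro tendsto_intros)
  ultimately show ?thesis by (simp add: sums_def C_def)
qed

text \<open>The energy cut-offs E([-n, n]) \<Phi> lie in the domain, since H multiplies norms there
  by at most n, and they converge to \<Phi>.\<close>

lemma closure_dom_free_dirac: "closure (dom (free_dirac m)) = UNIV"
proof -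
  have "\<Phi> \<in> closure (dom (free_dirac m))" for \<Phi>
  proof -
    let ?I = "\<lambda>n. {- real n..real n}"
    have sqI: "spectral_op m (?I n) \<Phi> \<in> dom (free_dirac m)" for n
    proof -
      have AE: "AE q in lebesgue. spinor_fun (spectral_op m (?I n) \<Phi>) q =
          spectral_matrix m (?I n) q *v spinor_fun \<Phi> q"
        by (rule AE_spectral_op) simp
      have "integrable lebesgue (\<lambda>q. (norm (dirac_symbol m q *v spinor_fun (spectral_op m (?I n) \<Phi>) q))\<^sup>2)"
      proof (rule Bochner_Integration.integrable_bound)
        show "integrable lebesgue (\<lambda>q. (real n)\<^sup>2 * (norm (spinor_fun (spectral_op m (?I n) \<Phi>) q))\<^sup>2)"
          using square_integrable_spinor_fun[of "spectral_op m (?I n) \<Phi>"] by (simp add: square_integrable_def)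
        have le: "(norm (dirac_symbol m q *v (spectral_matrix m (?I n) q *v v)))\<^sup>2 \<le>
            (real n)\<^sup>2 * (norm (spectral_matrix m (?I n) q *v v))\<^sup>2" for q v
        \<comment> \<open>If \<lambda> > n, both eigenvalues lie outside the symmetric interval and
          the cut-off vector is 0.\<close>
        proof (cases "dirac_energy m q \<le> n")
          case True
          then have "(dirac_energy m q)\<^sup>2 \<le> (real n)\<^sup>2"
            by (intro power_mono dirac_energy_nonneg)
          then show ?thesis by (simp add: norm_dirac_symbol power_mult_distrib mult_right_mono)
        qed (simp add: spectral_matrix_mult)
        show "AE q in lebesgue. norm ((norm (dirac_symbol m q *v spinor_fun (spectral_op m (?I n) \<Phi>) q))\<^sup>2)
            \<le> norm ((real n)\<^sup>2 * (norm (spinor_fun (spectral_op m (?I n) \<Phi>) q))\<^sup>2)"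
          using AE by eventually_elim (simp add: le)
      qed measurable
      then show ?thesis by (simp add: dom_free_dirac square_integrable_def)
    qed
    have "(\<lambda>n. spectral_op m (- ?I n) \<Phi>) \<longlonglongrightarrow> 0"
    proof (rule spectral_op_tendsto_0)
      fix x :: real
      obtain N :: nat where "\<bar>x\<bar> \<le> real N" using real_arch_simple by blast
      then have "x \<notin> - ?I n" if "n \<ge> N" for n
        using that by auto
      then show "\<forall>\<^sub>F n in sequentially. x \<notin> - ?I n"
        by (rule eventually_sequentiallyI)
    qed simp
    then have "(\<lambda>n. \<Phi> - spectral_op m (- ?I n) \<Phi>) \<longlonglongrightarrow> \<Phi> - 0"
      by (intro tendsto_intros)
    moreover have "\<Phi> = spectral_op m (?I n) \<Phi> + spectral_op m (- ?I n) \<Phi>" for n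
      using spectral_op_disjoint_union[of "?I n" "- ?I n" \<Phi>] by (simp add: spectral_op_UNIV)
    then have "(\<lambda>n. \<Phi> - spectral_op m (- ?I n) \<Phi>) = (\<lambda>n. spectral_op m (?I n) \<Phi>)"
      by (metis add_diff_cancel_right')
    ultimately show ?thesis
      unfolding closure_sequential using sqI
      by (intro exI[of _ "\<lambda>n. spectral_op m (?I n) \<Phi>"]) simp
  qed
  then show ?thesis by blast
qed

end

section \<open>The vector measures as push-forwards under the energy\<close>

text \<open>A vector measure is known only by its values on Borel sets; induction over measurable
  functions carries its splitting into two measures over to integrals.\<close>

lemma nn_integral_add_measure:
  assumes sets: "sets N = sets M" "sets N' = sets M"
    and M: "\<And>B. B \<in> sets M \<Longrightarrow> emeasure M B = emeasure N B + emeasure N' B"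
    and g: "g \<in> borel_measurable M"
  shows "(\<integral>\<^sup>+x. g x \<partial>M) = (\<integral>\<^sup>+x. g x \<partial>N) + (\<integral>\<^sup>+x. g x \<partial>N')"
proof -
  have meas: "h \<in> borel_measurable N" "h \<in> borel_measurable N'"
    if "h \<in> borel_measurable M" for h :: "_ \<Rightarrow> ennreal"
    using that measurable_cong_sets[OF sets(1) refl] measurable_cong_sets[OF sets(2) refl] by auto
  have space: "space N = space M" "space N' = space M"
    using sets by (auto dest: sets_eq_imp_space_eq)
  from g show ?thesis
  proof (induction rule: borel_measurable_induct)
    case (cong f h)
    moreover have "(\<integral>\<^sup>+x. f x \<partial>K) = (\<integral>\<^sup>+x. h x \<partial>K)" if "space K = space M" for K
      using cong(3) that by (intro nn_integral_cong) auto
    ultimately show ?case using space by simp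
  next
    case (set B)
    then show ?case using sets M by simp
  next
    case (mult u c)
    then show ?case by (simp add: nn_integral_cmult meas distrib_left)
  next
    case (add u v)
    then show ?case by (simp add: nn_integral_add meas ac_simps)
  next
    case (seq U)
    have U: "\<And>i. U i \<in> borel_measurable M" by fact
    have IH: "\<And>i. (\<integral>\<^sup>+x. U i x \<partial>M) = (\<integral>\<^sup>+x. U i x \<partial>N) + (\<integral>\<^sup>+x. U i x \<partial>N')" by fact
    have SUP: "(\<integral>\<^sup>+x. (SUP i. U i) x \<partial>K) = (SUP i. \<integral>\<^sup>+x. U i x \<partial>K)"
      if "\<And>i. U i \<in> borel_measurable K" for K
      unfolding SUP_apply using nn_integral_monotone_convergence_SUP[OF \<open>incseq U\<close> that] .
    have inc: "incseq (\<lambda>i. \<integral>\<^sup>+x. U i x \<partial>K)" for K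
      using \<open>incseq U\<close> by (auto simp: incseq_def le_fun_def intro!: nn_integral_mono)
    show ?case
      unfolding \<open>g = _\<close> SUP[OF U] SUP[OF meas(1)[OF U]] SUP[OF meas(2)[OF U]] IH
      by (rule ennreal_SUP_add[OF inc inc])
  qed
qed

context
  fixes m :: real
  assumes m: "m > 0"
begin

text \<open>The contribution of one sign of the energy to the vector measure. As a genuine
  push-forward it brings the countable additivity that the \<open>measure_of\<close> in
  \<open>vector_measure\<close> requires.\<close>

definition energy_measure :: "real \<Rightarrow> spinor_field \<Rightarrow> real measure" where
  "energy_measure s \<Phi> =
     distr (density lebesgue (\<lambda>q. ennreal ((norm (energy_projector m s q *v spinor_fun \<Phi> q))\<^sup>2)))
       borel (\<lambda>q. s * dirac_energy m q)"

lemma nn_integral_energy_measure: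
  assumes [measurable]: "g \<in> borel_measurable borel"
  shows "(\<integral>\<^sup>+x. g x \<partial>energy_measure s \<Phi>) =
    (\<integral>\<^sup>+q. ennreal ((norm (energy_projector m s q *v spinor_fun \<Phi> q))\<^sup>2) * g (s * dirac_energy m q) \<partial>lebesgue)"
proof -
  have [measurable]: "(\<lambda>q. s * dirac_energy m q) \<in> borel_measurable lebesgue"
    by measurable
  have "(\<lambda>q. g (s * dirac_energy m q)) \<in> borel_measurable lebesgue"
    by measurable
  then show ?thesis
    unfolding energy_measure_def by (subst nn_integral_distr) (simp_all add: nn_integral_density)
qed

lemma integrable_energy_projector:
  "integrable lebesgue (\<lambda>q. (norm (energy_projector m (-1) q *v spinor_fun \<Phi> q))\<^sup>2)"
  "integrable lebesgue (\<lambda>q. (norm (energy_projector m 1 q *v spinor_fun \<Phi> q))\<^sup>2)"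
proof -
  have I: "integrable lebesgue (\<lambda>q. (norm (spinor_fun \<Phi> q))\<^sup>2)"
    using square_integrable_spinor_fun[of \<Phi>] by (simp add: square_integrable_def)
  have le: "norm (energy_projector m (-1) q *v v) \<le> norm v" for q v
    by (rule power2_le_imp_le) (simp_all flip: norm_energy_projectors_sq[OF m, of q v])
  have le': "norm (energy_projector m 1 q *v v) \<le> norm v" for q v
    by (rule power2_le_imp_le) (simp_all flip: norm_energy_projectors_sq[OF m, of q v])
  show "integrable lebesgue (\<lambda>q. (norm (energy_projector m (-1) q *v spinor_fun \<Phi> q))\<^sup>2)"
    by (rule Bochner_Integration.integrable_bound[OF I])
       (measurable, use le le' in simp)
  show "integrable lebesgue (\<lambda>q. (norm (energy_projector m 1 q *v spinor_fun \<Phi> q))\<^sup>2)"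
    by (rule Bochner_Integration.integrable_bound[OF I])
       (measurable, use le le' in simp)
qed

lemma Re_cinner_spectral_op:
  assumes B [measurable]: "B \<in> sets borel"
  shows "ennreal (Re (cinner (spectral_op m B \<Phi>) \<Phi>)) =
    emeasure (energy_measure (-1) \<Phi>) B + emeasure (energy_measure 1 \<Phi>) B"
proof -
  let ?a = "\<lambda>q. (norm (energy_projector m (-1) q *v spinor_fun \<Phi> q))\<^sup>2"
  let ?b = "\<lambda>q. (norm (energy_projector m 1 q *v spinor_fun \<Phi> q))\<^sup>2"
  let ?h = "\<lambda>q. indicator B (- dirac_energy m q) * ?a q + indicator B (dirac_energy m q) * ?b q"
  have "cinner (spectral_op m B \<Phi>) \<Phi> =
      (\<integral>q. cdot (spectral_matrix m B q *v spinor_fun \<Phi> q) (spinor_fun \<Phi> q) \<partial>lebesgue)"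
    by (rule cinner_eq_integral[OF AE_spectral_op[OF m B]]) simp_all
  also have "\<dots> = of_real (\<integral>q. ?h q \<partial>lebesgue)"
    unfolding cdot_spectral_matrix[OF m] integral_complex_of_real ..
  finally have "Re (cinner (spectral_op m B \<Phi>) \<Phi>) = (\<integral>q. ?h q \<partial>lebesgue)"
    by simp
  moreover have int: "integrable lebesgue ?h"
  proof (rule Bochner_Integration.integrable_bound)
    show "integrable lebesgue (\<lambda>q. ?a q + ?b q)"
      by (intro Bochner_Integration.integrable_add integrable_energy_projector)
  qed (measurable, auto simp: indicator_def)
  ultimately have "ennreal (Re (cinner (spectral_op m B \<Phi>) \<Phi>)) = (\<integral>\<^sup>+q. ennreal (?h q) \<partial>lebesgue)"
    by (simp only: nn_integral_eq_integral[OF int AE_I2] zero_le_power2 mult_nonneg_nonneg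
        indicator_pos_le add_nonneg_nonneg)
  also have "\<dots> = (\<integral>\<^sup>+q. ennreal (?a q) * indicator B (- 1 * dirac_energy m q) +
      ennreal (?b q) * indicator B (1 * dirac_energy m q) \<partial>lebesgue)"
    by (intro nn_integral_cong) (simp add: indicator_def)
  also have "\<dots> = (\<integral>\<^sup>+q. ennreal (?a q) * indicator B (- 1 * dirac_energy m q) \<partial>lebesgue) +
      (\<integral>\<^sup>+q. ennreal (?b q) * indicator B (1 * dirac_energy m q) \<partial>lebesgue)"
    by (rule nn_integral_add) measurable
  also have "\<dots> = emeasure (energy_measure (-1) \<Phi>) B + emeasure (energy_measure 1 \<Phi>) B"
    unfolding nn_integral_energy_measure[OF borel_measurable_indicator[OF B], symmetric]
    by (simp add: energy_measure_def)
  finally show ?thesis .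
qed

lemma sets_energy_measure [simp]: "sets (energy_measure s \<Phi>) = sets borel"
  by (simp add: energy_measure_def)

lemma sets_vector_measure: "sets (vector_measure E f) = sets borel"
  unfolding vector_measure_def by (simp add: sets.sigma_sets_eq[of borel, simplified])

lemma emeasure_vector_measure:
  assumes B: "B \<in> sets borel"
  shows "emeasure (vector_measure (spectral_op m) \<Phi>) B =
    emeasure (energy_measure (-1) \<Phi>) B + emeasure (energy_measure 1 \<Phi>) B"
proof -
  let ?\<mu> = "\<lambda>B. ennreal (Re (cinner (spectral_op m B \<Phi>) \<Phi>))"
  have "emeasure (vector_measure (spectral_op m) \<Phi>) B = ?\<mu> B"
    unfolding vector_measure_def
  proof (rule emeasure_measure_of_sigma)
    show "sigma_algebra UNIV (sets (borel :: real measure))"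
      using sets.sigma_algebra_axioms[of "borel :: real measure"] by simp
    show "positive (sets borel) ?\<mu>"
      using Re_cinner_spectral_op[of "{}" \<Phi>] by (simp add: positive_def)
    show "countably_additive (sets borel) ?\<mu>"
    proof (rule countably_additiveI)
      fix F :: "nat \<Rightarrow> real set"
      assume F: "range F \<subseteq> sets borel" "disjoint_family F" "\<Union> (range F) \<in> sets borel"
      then have "F i \<in> sets borel" for i by auto
      then show "(\<Sum>i. ?\<mu> (F i)) = ?\<mu> (\<Union> (range F))"
        using F by (simp add: Re_cinner_spectral_op suminf_add[symmetric] suminf_emeasure)
    qed
  qed (rule B)
  then show ?thesis using Re_cinner_spectral_op[OF B] by simp
qed

lemma nn_integral_vector_measure:
  assumes g: "g \<in> borel_measurable borel"
  shows "(\<integral>\<^sup>+x. g x \<partial>vector_measure (spectral_op m) \<Phi>) =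
    (\<integral>\<^sup>+q. ennreal ((norm (energy_projector m (-1) q *v spinor_fun \<Phi> q))\<^sup>2) * g (- dirac_energy m q) \<partial>lebesgue) +
    (\<integral>\<^sup>+q. ennreal ((norm (energy_projector m 1 q *v spinor_fun \<Phi> q))\<^sup>2) * g (dirac_energy m q) \<partial>lebesgue)"
proof -
  have "(\<integral>\<^sup>+x. g x \<partial>vector_measure (spectral_op m) \<Phi>) =
      (\<integral>\<^sup>+x. g x \<partial>energy_measure (-1) \<Phi>) + (\<integral>\<^sup>+x. g x \<partial>energy_measure 1 \<Phi>)"
    by (rule nn_integral_add_measure)
       (use g measurable_cong_sets[OF sets_vector_measure refl] in
         \<open>auto simp: sets_vector_measure emeasure_vector_measure\<close>)
  then show ?thesis by (simp add: nn_integral_energy_measure[OF g])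
qed

lemma measurable_vector_measure:
  "g \<in> borel_measurable borel \<Longrightarrow> g \<in> borel_measurable (vector_measure E f)"
  using measurable_cong_sets[OF sets_vector_measure refl] by blast

text \<open>The second moment is the integral of \<lambda>^2 (|P_- \<Phi>|^2 + |P_+ \<Phi>|^2),
  which is that of |H \<Phi>|^2.\<close>

lemma integrable_square_vector_measure:
  "integrable (vector_measure (spectral_op m) \<Phi>) (\<lambda>x. x\<^sup>2) \<longleftrightarrow> \<Phi> \<in> dom (free_dirac m)"
proof -
  let ?a = "\<lambda>q. (norm (energy_projector m (-1) q *v spinor_fun \<Phi> q))\<^sup>2"
  let ?b = "\<lambda>q. (norm (energy_projector m 1 q *v spinor_fun \<Phi> q))\<^sup>2"
  have "(\<integral>\<^sup>+x. ennreal (norm (x\<^sup>2)) \<partial>vector_measure (spectral_op m) \<Phi>) =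
      (\<integral>\<^sup>+q. ennreal (?a q) * ennreal ((dirac_energy m q)\<^sup>2) + ennreal (?b q) * ennreal ((dirac_energy m q)\<^sup>2) \<partial>lebesgue)"
    by (subst nn_integral_vector_measure) (simp_all add: nn_integral_add)
  also have "\<dots> = (\<integral>\<^sup>+q. ennreal ((norm (dirac_symbol m q *v spinor_fun \<Phi> q))\<^sup>2) \<partial>lebesgue)"
  proof (rule nn_integral_cong)
    fix q
    have "?a q * (dirac_energy m q)\<^sup>2 + ?b q * (dirac_energy m q)\<^sup>2 = (norm (dirac_symbol m q *v spinor_fun \<Phi> q))\<^sup>2"
      unfolding norm_dirac_symbol power_mult_distrib
        norm_energy_projectors_sq[OF m, of q "spinor_fun \<Phi> q", symmetric]
      by (simp add: algebra_simps)
    then show "ennreal (?a q) * ennreal ((dirac_energy m q)\<^sup>2) + ennreal (?b q) * ennreal ((dirac_energy m q)\<^sup>2) =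
        ennreal ((norm (dirac_symbol m q *v spinor_fun \<Phi> q))\<^sup>2)"
      by (simp flip: ennreal_mult ennreal_plus)
  qed
  finally have "(\<integral>\<^sup>+x. ennreal (norm (x\<^sup>2)) \<partial>vector_measure (spectral_op m) \<Phi>) = \<dots>" .
  moreover have "(\<lambda>x. x\<^sup>2 :: real) \<in> borel_measurable (vector_measure (spectral_op m) \<Phi>)"
    by (rule measurable_vector_measure) measurable
  ultimately show ?thesis
    by (simp add: dom_free_dirac square_integrable_def integrable_iff_bounded)
qed

lemma cinner_free_dirac:
  assumes A: "free_dirac m \<Phi> = Some \<Psi>"
  shows "cinner \<Psi> \<Phi> = complex_of_real (\<integral>x. x \<partial>vector_measure (spectral_op m) \<Phi>)"
proof -
  let ?a = "\<lambda>q. (norm (energy_projector m (-1) q *v spinor_fun \<Phi> q))\<^sup>2 * dirac_energy m q"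
  let ?b = "\<lambda>q. (norm (energy_projector m 1 q *v spinor_fun \<Phi> q))\<^sup>2 * dirac_energy m q"
  let ?\<mu> = "vector_measure (spectral_op m) \<Phi>"
  have pos: "0 \<le> ?a q" "0 \<le> ?b q" for q
    by (simp_all add: dirac_energy_nonneg)
  have I: "integrable lebesgue (\<lambda>q. (norm (spinor_fun \<Phi> q))\<^sup>2 + (norm (dirac_symbol m q *v spinor_fun \<Phi> q))\<^sup>2)"
    using A square_integrable_spinor_fun[of \<Phi>] dom_free_dirac[of m]
    by (intro Bochner_Integration.integrable_add) (auto simp: square_integrable_def)
  have sum: "?a q + ?b q = (norm (spinor_fun \<Phi> q))\<^sup>2 * dirac_energy m q" for q
    using norm_energy_projectors_sq[OF m, of q "spinor_fun \<Phi> q"] by (simp flip: distrib_right)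
  have bound: "?a q + ?b q \<le> (norm (spinor_fun \<Phi> q))\<^sup>2 + (norm (dirac_symbol m q *v spinor_fun \<Phi> q))\<^sup>2" for q
  proof -
    \<comment> \<open>From (\<lambda> - 1)^2 \<ge> 0. It makes \<lambda> |\<Phi>|^2 integrable,
      since \<Phi> and H \<Phi> are square integrable.\<close>
    have "dirac_energy m q \<le> 1 + (dirac_energy m q)\<^sup>2"
      using zero_le_power2[of "dirac_energy m q - 1"] dirac_energy_nonneg[of m q]
      unfolding power2_diff by simp
    then have "(norm (spinor_fun \<Phi> q))\<^sup>2 * dirac_energy m q \<le> (norm (spinor_fun \<Phi> q))\<^sup>2 * (1 + (dirac_energy m q)\<^sup>2)"
      by (intro mult_left_mono) auto
    then show ?thesis unfolding sum by (simp add: norm_dirac_symbol power_mult_distrib algebra_simps)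
  qed
  have le: "norm (?a q) \<le> norm ((norm (spinor_fun \<Phi> q))\<^sup>2 + (norm (dirac_symbol m q *v spinor_fun \<Phi> q))\<^sup>2)"
      "norm (?b q) \<le> norm ((norm (spinor_fun \<Phi> q))\<^sup>2 + (norm (dirac_symbol m q *v spinor_fun \<Phi> q))\<^sup>2)" for q
    using bound[of q] pos[of q] by (simp_all only: real_norm_def)
  have Ia: "integrable lebesgue ?a"
    by (rule Bochner_Integration.integrable_bound[OF I _ AE_I2[OF le(1)]]) measurable
  have Ib: "integrable lebesgue ?b"
    by (rule Bochner_Integration.integrable_bound[OF I _ AE_I2[OF le(2)]]) measurable
  \<comment> \<open>\<open>ennreal\<close> sends negative numbers to 0, so the positive part of x
    sees only the positive energies, and the negative part below only the negative ones.\<close>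
  have P: "(\<integral>\<^sup>+x. ennreal x \<partial>?\<mu>) = ennreal (\<integral>q. ?b q \<partial>lebesgue)"
    by (subst nn_integral_vector_measure)
       (simp_all add: ennreal_neg dirac_energy_nonneg nn_integral_eq_integral[OF Ib] flip: ennreal_mult)
  have N: "(\<integral>\<^sup>+x. ennreal (- x) \<partial>?\<mu>) = ennreal (\<integral>q. ?a q \<partial>lebesgue)"
    by (subst nn_integral_vector_measure)
       (simp_all add: ennreal_neg dirac_energy_nonneg nn_integral_eq_integral[OF Ia] flip: ennreal_mult)
  have "(\<integral>\<^sup>+x. ennreal (norm x) \<partial>?\<mu>) = ennreal (\<integral>q. ?a q \<partial>lebesgue) + ennreal (\<integral>q. ?b q \<partial>lebesgue)"
    by (subst nn_integral_vector_measure)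
       (simp_all add: dirac_energy_nonneg nn_integral_eq_integral[OF Ia] nn_integral_eq_integral[OF Ib]
          flip: ennreal_mult)
  moreover have "(\<lambda>x. x) \<in> borel_measurable ?\<mu>"
    by (rule measurable_vector_measure) measurable
  ultimately have "integrable ?\<mu> (\<lambda>x. x)"
    unfolding integrable_iff_bounded by simp
  then have "(\<integral>x. x \<partial>?\<mu>) = (\<integral>q. ?b q \<partial>lebesgue) - (\<integral>q. ?a q \<partial>lebesgue)"
    unfolding real_lebesgue_integral_def[OF \<open>integrable ?\<mu> (\<lambda>x. x)\<close>] P N
    by (simp add: integral_nonneg_AE pos)
  also have "\<dots> = (\<integral>q. ?b q - ?a q \<partial>lebesgue)"
    using Ia Ib by simp
  finally have 1: "(\<integral>x. x \<partial>?\<mu>) = (\<integral>q. ?b q - ?a q \<partial>lebesgue)" .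
  have "cinner \<Psi> \<Phi> = (\<integral>q. cdot (dirac_symbol m q *v spinor_fun \<Phi> q) (spinor_fun \<Phi> q) \<partial>lebesgue)"
    using A unfolding free_dirac_eq_Some by (intro cinner_eq_integral) simp_all
  also have "\<dots> = of_real (\<integral>q. ?b q - ?a q \<partial>lebesgue)"
    unfolding cdot_dirac_symbol[OF m] integral_complex_of_real by (simp add: algebra_simps)
  finally show ?thesis unfolding 1 .
qed

lemma spectral_measure_free_dirac: "spectral_measure (free_dirac m) (spectral_op m)"
  unfolding spectral_measure_def
proof (intro conjI ballI allI impI)
  show "linear_operator (free_dirac m)"
    by (rule linear_operator_free_dirac)
  show "dom (free_dirac m) = {f. integrable (vector_measure (spectral_op m) f) (\<lambda>x. x\<^sup>2)}"
    using integrable_square_vector_measure by blast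
  show "spectral_op m UNIV = id"
    using spectral_op_UNIV[OF m] by auto
  show "(\<lambda>n. spectral_op m (B n) f) sums spectral_op m (\<Union>n. B n) f"
    if "range B \<subseteq> sets borel \<and> disjoint_family B" for B f
    using that by (intro spectral_op_sums m) auto
  show "cinner (the (free_dirac m f)) f = complex_of_real (\<integral>x. x \<partial>vector_measure (spectral_op m) f)"
    if "f \<in> dom (free_dirac m)" for f
    using that cinner_free_dirac by auto
qed (use clinear_on_spectral_op[OF m] spectral_op_idem[OF m] spectral_op_adjoint[OF m] in auto)

lemma ac_subspace_free_dirac: "ac_subspace (free_dirac m) = UNIV"
proof -
  have "absolutely_continuous lborel (vector_measure (spectral_op m) \<Phi>)" for \<Phi>
    unfolding absolutely_continuous_def
  proof
    fix N :: "real set" assume N: "N \<in> null_sets lborel"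
    then have [measurable]: "N \<in> sets borel" by auto
    have AE: "AE q in lebesgue. dirac_energy m q \<notin> N" "AE q in lebesgue. - dirac_energy m q \<notin> N"
      using AE_dirac_energy_notin[OF N, of 1 m] AE_dirac_energy_notin[OF N, of "-1" m] by simp_all
    have "emeasure (vector_measure (spectral_op m) \<Phi>) N =
        (\<integral>\<^sup>+x. indicator N x \<partial>vector_measure (spectral_op m) \<Phi>)"
      by (simp add: sets_vector_measure)
    also have "\<dots> = 0"
    proof -
      have "(\<integral>\<^sup>+q. ennreal ((norm (energy_projector m (-1) q *v spinor_fun \<Phi> q))\<^sup>2) *
            indicator N (- dirac_energy m q) \<partial>lebesgue) = (\<integral>\<^sup>+q. 0 \<partial>(lebesgue :: (real^3) measure))"
        by (rule nn_integral_cong_AE) (use AE(2) in \<open>eventually_elim, simp\<close>)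
      moreover have "(\<integral>\<^sup>+q. ennreal ((norm (energy_projector m 1 q *v spinor_fun \<Phi> q))\<^sup>2) *
            indicator N (dirac_energy m q) \<partial>lebesgue) = (\<integral>\<^sup>+q. 0 \<partial>(lebesgue :: (real^3) measure))"
        by (rule nn_integral_cong_AE) (use AE(1) in \<open>eventually_elim, simp\<close>)
      ultimately show ?thesis
        by (simp add: nn_integral_vector_measure)
    qed
    finally show "N \<in> null_sets (vector_measure (spectral_op m) \<Phi>)"
      by (simp add: null_sets_def sets_vector_measure)
  qed
  then show ?thesis
    using spectral_measure_free_dirac by (auto simp: ac_subspace_def)
qed

end

theorem theorem7p1:
  fixes m R :: real
    and U :: "real^3 \<Rightarrow> real^3 \<Rightarrow> complex^4^4"
    and A :: "spinor_field \<rightharpoonup> spinor_field"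
    and W0 :: "real \<Rightarrow> spinor_field \<Rightarrow> spinor_field"
    and Wp Wm S :: "spinor_field \<Rightarrow> spinor_field"
    and Sq :: "real^3 \<Rightarrow> complex^4^4"
    and W0q :: "real \<Rightarrow> real^3 \<Rightarrow> complex^4^4"
  assumes "m > 0"
    and "self_adjoint A" and "perturbed_dirac m U A"
    and "generalized_wave_operators A (free_dirac m) R W0 Wp Wm"
    and "scattering_operator Wp Wm S"
  shows "(matrix_function_of UNIV S Sq \<longrightarrow>
            (AE q in lebesgue.
               Sq q = (\<Sum>n=1..2. dirac_projector m n q ** Sq q ** dirac_projector m n q))) \<and>
         ((\<forall>t. R < \<bar>t\<bar> \<longrightarrow> matrix_function_of (ac_subspace (free_dirac m)) (W0 t) (W0q t)) \<longrightarrow>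
            (\<forall>t. R < \<bar>t\<bar> \<longrightarrow>
              (AE q in lebesgue.
                 W0q t q =
                   (\<Sum>n=1..2. dirac_projector m n q ** W0q t q ** dirac_projector m n q))))"
proof (intro conjI impI allI)
  note G = ac_subspace_free_dirac[OF \<open>m > 0\<close>]
  show "AE q in lebesgue. Sq q = (\<Sum>n=1..2. dirac_projector m n q ** Sq q ** dirac_projector m n q)"
    if "matrix_function_of UNIV S Sq"
    by (rule matrix_function_decomposition[OF \<open>m > 0\<close> that])
       (rule scattering_operator_commutes[OF G assms(2) linear_operator_free_dirac symmetric_operator_free_dirac
          closure_dom_free_dirac[OF \<open>m > 0\<close>] assms(4,5)])
  fix t assume W: "\<forall>t. R < \<bar>t\<bar> \<longrightarrow> matrix_function_of (ac_subspace (free_dirac m)) (W0 t) (W0q t)"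
    and t: "R < \<bar>t\<bar>"
  \<comment> \<open>With the absolutely continuous subspace equal to the whole space, the projector
    in the second clause of the deviation factor is the identity.\<close>
  have "map_option (W0 t) (free_dirac m f) = free_dirac m (W0 t f)" for f
    using assms(4) t
    by (auto simp: generalized_wave_operators_def deviation_factor_def Let_def G proj_onto_UNIV)
  then have com: "free_dirac m (W0 t f) = Some (W0 t g)" if "free_dirac m f = Some g" for f g
    using that by (metis option.simps(9))
  show "AE q in lebesgue. W0q t q = (\<Sum>n=1..2. dirac_projector m n q ** W0q t q ** dirac_projector m n q)"
    by (rule matrix_function_decomposition[OF \<open>m > 0\<close> _ com]) (use W t G in auto)
qed

end
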